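(* Let $H$ be a Hilbert space, $Y=\mathbb{R}$, $T>0$, let $A$ be an operator in $H$ with domain $D(A)$ and let $O:H\supset D(O)\to Y$ be an observation operator. Assume: (a) the spectrum of $A$ consists of eigenvalues $\{\lambda_k\}_{k=1}^\infty$ with algebraic multiplicities $L_k$, $k\in\mathbb{N}$, and there are root vectors $\{\phi_k^i\}$ of $A$ and $\{\psi_k^i\}$ of $A^*$ ($i=1,\ldots,L_k$, $k\in\mathbb{N}$), each family (consisting of all root vectors) forming a Riesz basis in $H$, such that $$(A-\lambda_k)\phi_k^1=0,\qquad (A-\lambda_k)\phi_k^i=\phi_k^{i-1},\quad 2\le i\le L_k,$$ $$(A^*-\overline{\lambda_k})\psi_k^{L_k}=0,\qquad (A^*-\overline{\lambda_k})\psi_k^i=\psi_k^{i+1},\quad 1\le i\le L_k-1,$$ with $(\phi_k^i,\psi_l^j)_H=0$ if $k\ne l$ or $i\neq j$, and $(\phi_k^i,\psi_k^i)_H=1$; (b) the control system $v_t+A^*v=Bf$, $t<T$, $v(T)=0$, with $B=O^*$, is spectrally controllable in time $T$: there exist controls $f_k^i\in H_0^1(0,T;Y)$ such that $W^0f_k^i=\psi_k^i$ for $i=1,\ldots,L_k$, $k\in\mathbb{N}$, where $W^0f:=v^f(0)$; (c) the source $a\in H$ is generic, i.e. in the expansion $a=\sum_{k=1}^\infty\sum_{i=1}^{L_k}a_k^i\phi_k^i$ one has $a_k^i\neq 0$ for all $k,i$. Let $y(t)=(\mathbb{O}a)(t)=(Ou^a)(t)$, $0<t<2T$, where $u^a$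 is the solution of $u_t-Au=0$, $t>0$, $u(0)=a$. Then the spectrum $\{\lambda_k\}$ of $A$ and the controls $f_k^i$ ($i=1,\ldots,L_k$, $k\in\mathbb{N}$) are the spectrum and the root vectors of the generalized spectral problem for the unknown pair $(\lambda,f)$ $$\int_0^{2T}\bigl(\dot y(t)-\lambda y(t),\,f(t-T+\tau)\bigr)_Y\,dt=0,\qquad 0<\tau<T.$$
   Context: $H$ and $Y$ are Hilbert spaces; $A^*$ is the adjoint of $A$ and $B:=O^*:Y\to H$ is the adjoint of $O$. Inner products are linear in the first argument and conjugate-linear in the second; the case $Y=\mathbb{R}$ means scalar observations and controls (with complex scalars allowed where complex eigenvalues and root vectors require it). For $a\in H$, $u^a$ denotes the solution of $u_t-Au=0$, $t>0$, $u(0)=a$, and $\mathbb{O}a:=Ou^a$ is the observation; it is assumed that $y=\mathbb{O}a\in L_2(0,2T;Y)$. For $f\in L_2(0,T;Y)$, $v^f$ denotes the solution of the backward control system $v_t+A^*v=Bf$, $t<T$, $v(T)=0$, and $W^sf:=v^f(s)$ for $0\le s<T$ is the control operator. The dot denotes differentiation in $t$; for $f\in H^1_0(0,T;Y)$ the term with $\dot y$ may be understood through integration by parts. All functions $f$ (in particular the controls $f_k^i$) are extended by zero outside $(0,T)$. In the generalized spectral problem the unknown $f$ is a nonzero element of $H_0^1(0,T;Y)$ and $\lambda\in\mathbb{C}$; the spectrum is the set of $\lambda$ for which such $f$ exists. Root vectors for an eigenvalue $\lambda$ are the elements of chains $\{f^1,\ldots,f^L\}$ satisfying, with the convention $f^{L+1}=0$,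 $$\int_0^{2T}\bigl(\dot y(t)-\lambda y(t),f^i(t-T+\tau)\bigr)_Y\,dt=\int_0^{2T}\bigl(y(t),f^{i+1}(t-T+\tau)\bigr)_Y\,dt,\qquad 0<\tau<T,\ i=1,\ldots,L.$$ The chain attached to $\lambda_k$ is $\{f_k^1,\ldots,f_k^{L_k}\}$, with eigenvector $f_k^{L_k}$.
   Formalization: Any nonzero f in H_0^1 with W^0 f=0 solves the problem for every λ, so the spectrum can be all of ℂ; spectrum and root vectors are therefore identified modulo such f (those with all integrals of (y, f(t-T+τ)) zero), and literally, with root vectors the spans of the f_k^i, if f=0 is the only one. *)

theory Defs
  imports "HOL-Analysis.Analysis"
begin

section \<open>Complex Hilbert spaces\<close>

text \<open>The inner product \<open>cinner\<close> is linear in the first and conjugate-linear in the second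
  argument; the real inner product and the norm of the underlying type are the induced ones.\<close>

class complex_hilbert = real_inner + banach +
  fixes scaleC :: "complex \<Rightarrow> 'a \<Rightarrow> 'a" (infixr "*\<^sub>C" 75)
    and cinner :: "'a \<Rightarrow> 'a \<Rightarrow> complex"
  assumes scaleC_add_right: "c *\<^sub>C (x + y) = c *\<^sub>C x + c *\<^sub>C y"
    and scaleC_add_left: "(c + d) *\<^sub>C x = c *\<^sub>C x + d *\<^sub>C x"
    and scaleC_scaleC: "c *\<^sub>C d *\<^sub>C x = (c * d) *\<^sub>C x"
    and scaleC_of_real: "complex_of_real r *\<^sub>C x = r *\<^sub>R x"
    and cinner_add_left: "cinner (x + y) z = cinner x z + cinner y z"
    and cinner_scaleC_left: "cinner (c *\<^sub>C x) y = c * cinner x y"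
    and cinner_commute: "cinner x y = cnj (cinner y x)"
    and inner_eq_Re_cinner: "x \<bullet> y = Re (cinner x y)"

interpretation complex_vector: vector_space "scaleC :: complex \<Rightarrow> 'a \<Rightarrow> 'a::complex_hilbert"
proof
  show "1 *\<^sub>C x = x" for x :: 'a
    using scaleC_of_real[of 1 x] by simp
qed (simp_all add: scaleC_add_right scaleC_add_left scaleC_scaleC)

text \<open>The space of scalar observations and controls is \<open>complex\<close>, with
  \<open>cinner a b = a * cnj b\<close>.\<close>

instantiation complex :: complex_hilbert
begin

definition scaleC_complex :: "complex \<Rightarrow> complex \<Rightarrow> complex"
  where "scaleC_complex c x = c * x"

definition cinner_complex :: "complex \<Rightarrow> complex \<Rightarrow> complex"
  where "cinner_complex x y = x * cnj y"

instance
  by standard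
    (simp_all add: scaleC_complex_def cinner_complex_def algebra_simps inner_complex_def
      scaleR_conv_of_real)

end


section \<open>Operators\<close>

text \<open>An operator is a function together with its domain \<open>D\<close>; its values outside \<open>D\<close> are
  irrelevant.\<close>

definition linear_on :: "'a set \<Rightarrow> ('a::complex_hilbert \<Rightarrow> 'b::complex_hilbert) \<Rightarrow> bool" where
  "linear_on D F \<longleftrightarrow> complex_vector.subspace D \<and>
     (\<forall>x\<in>D. \<forall>y\<in>D. F (x + y) = F x + F y) \<and> (\<forall>c. \<forall>x\<in>D. F (c *\<^sub>C x) = c *\<^sub>C F x)"

definition adj_dom :: "'a set \<Rightarrow> ('a::complex_hilbert \<Rightarrow> 'b::complex_hilbert) \<Rightarrow> 'b set" where
  "adj_dom D A = {y. \<exists>z. \<forall>x\<in>D. cinner (A x) y = cinner x z}"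

text \<open>Well defined on \<open>adj_dom D A\<close> whenever \<open>D\<close> is dense.\<close>

definition adj_op :: "'a set \<Rightarrow> ('a::complex_hilbert \<Rightarrow> 'b::complex_hilbert) \<Rightarrow> 'b \<Rightarrow> 'a" where
  "adj_op D A y = (THE z. \<forall>x\<in>D. cinner (A x) y = cinner x z)"

definition op_spectrum :: "'a set \<Rightarrow> ('a::complex_hilbert \<Rightarrow> 'a) \<Rightarrow> complex set" where
  "op_spectrum D A = - {\<mu>. bij_betw (\<lambda>x. A x - \<mu> *\<^sub>C x) D UNIV \<and>
                          (\<exists>C. \<forall>x\<in>D. norm x \<le> C * norm (A x - \<mu> *\<^sub>C x))}"

fun power_kernel :: "'a set \<Rightarrow> ('a::complex_hilbert \<Rightarrow> 'a) \<Rightarrow> complex \<Rightarrow> nat \<Rightarrow> 'a set" where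
  "power_kernel D A \<mu> 0 = {0}"
| "power_kernel D A \<mu> (Suc n) = {x \<in> D. A x - \<mu> *\<^sub>C x \<in> power_kernel D A \<mu> n}"

definition root_space :: "'a set \<Rightarrow> ('a::complex_hilbert \<Rightarrow> 'a) \<Rightarrow> complex \<Rightarrow> 'a set" where
  "root_space D A \<mu> = (\<Union>n. power_kernel D A \<mu> n)"

definition alg_mult :: "'a set \<Rightarrow> ('a::complex_hilbert \<Rightarrow> 'a) \<Rightarrow> complex \<Rightarrow> nat" where
  "alg_mult D A \<mu> = complex_vector.dim (root_space D A \<mu>)"

definition riesz_basis :: "'i set \<Rightarrow> ('i \<Rightarrow> 'a::complex_hilbert) \<Rightarrow> bool" where
  "riesz_basis I e \<longleftrightarrow> closure (complex_vector.span (e ` I)) = UNIV \<and>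
     (\<exists>c C. 0 < c \<and> (\<forall>F a. finite F \<and> F \<subseteq> I \<longrightarrow>
        c * (\<Sum>i\<in>F. (cmod (a i))\<^sup>2) \<le> (norm (\<Sum>i\<in>F. a i *\<^sub>C e i))\<^sup>2 \<and>
        (norm (\<Sum>i\<in>F. a i *\<^sub>C e i))\<^sup>2 \<le> C * (\<Sum>i\<in>F. (cmod (a i))\<^sup>2)))"


section \<open>Function spaces\<close>

definition L2_on :: "real set \<Rightarrow> (real \<Rightarrow> complex) set" where
  "L2_on S = {g. set_borel_measurable lborel S g \<and>
                 set_integrable lborel S (\<lambda>t. (cmod (g t))\<^sup>2)}"

text \<open>Elements of \<open>H01 T\<close> are represented by their continuous version and, like their
  derivatives, extended by zero outside \<open>(0, T)\<close>. Two of them are equal in the Sobolev space iff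
  they are equal as functions; the derivative \<open>wderiv\<close> is determined up to a null set.\<close>

definition is_wderiv :: "real \<Rightarrow> (real \<Rightarrow> complex) \<Rightarrow> (real \<Rightarrow> complex) \<Rightarrow> bool" where
  "is_wderiv T f g \<longleftrightarrow> g \<in> L2_on {0<..<T} \<and> (\<forall>t. t \<notin> {0<..<T} \<longrightarrow> g t = 0 \<and> f t = 0) \<and>
     (\<forall>t\<in>{0..T}. f t = (LINT s:{0<..<t}|lborel. g s))"

definition H01 :: "real \<Rightarrow> (real \<Rightarrow> complex) set" where
  "H01 T = {f. \<exists>g. is_wderiv T f g}"

definition wderiv :: "real \<Rightarrow> (real \<Rightarrow> complex) \<Rightarrow> real \<Rightarrow> complex" where
  "wderiv T f = (SOME g. is_wderiv T f g)"


section \<open>Observation and control systems\<close>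

text \<open>The (mild) solution of \<open>u' = A u\<close>, \<open>u(0) = a\<close>: the equation integrated in time, so that
  arbitrary \<open>a\<close> are admitted.\<close>

definition mild_solution ::
    "'a set \<Rightarrow> ('a::complex_hilbert \<Rightarrow> 'a) \<Rightarrow> 'a \<Rightarrow> (real \<Rightarrow> 'a) \<Rightarrow> bool" where
  "mild_solution D A a u \<longleftrightarrow> continuous_on {0..} u \<and> u 0 = a \<and>
     (\<forall>t\<ge>0. integral {0..t} u \<in> D \<and> u t = a + A (integral {0..t} u))"

text \<open>\<open>y = O u\<close> on \<open>(0, S)\<close>. A mild solution need not take its values in the domain of an
  unbounded \<open>O\<close>, but its time integrals lie in the domain of \<open>A\<close>; hence the observation is also
  expressed after integration in time. For bounded \<open>O\<close> this is the pointwise identity, see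
  \<open>observation_bounded\<close>.\<close>

definition is_observation ::
    "('a::complex_hilbert \<Rightarrow> complex) \<Rightarrow> real \<Rightarrow> (real \<Rightarrow> 'a) \<Rightarrow> (real \<Rightarrow> complex) \<Rightarrow> bool" where
  "is_observation Obs S u y \<longleftrightarrow> y \<in> L2_on {0<..<S} \<and>
     (\<forall>t\<in>{0..S}. Obs (integral {0..t} u) = (LINT s:{0<..<t}|lborel. y s))"

text \<open>The adjoint \<open>B = O\<^sup>*\<close> through the pairing \<open>(B c, x)\<^sub>H = (c, O x)\<^sub>Y\<close> with \<open>x\<close> in the domain
  of \<open>A\<close>. This is the usual meaning of \<open>B\<close> if \<open>O\<close> is unbounded; if the Hilbert space adjoint is
  defined on all of \<open>Y\<close> the two agree, see \<open>obs_adjoint_eq\<close>.\<close>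

definition obs_adjoint :: "('a::complex_hilbert \<Rightarrow> complex) \<Rightarrow> complex \<Rightarrow> 'a \<Rightarrow> complex" where
  "obs_adjoint Obs c x = cinner c (Obs x)"

text \<open>The (weak) solution of \<open>v' + A\<^sup>* v = B g\<close>, \<open>v(T) = 0\<close>, on \<open>[0, T]\<close>.\<close>

definition backward_solution ::
    "'a set \<Rightarrow> ('a::complex_hilbert \<Rightarrow> 'a) \<Rightarrow> ('a \<Rightarrow> complex) \<Rightarrow> real \<Rightarrow> (real \<Rightarrow> complex) \<Rightarrow>
     (real \<Rightarrow> 'a) \<Rightarrow> bool" where
  "backward_solution D A Obs T g v \<longleftrightarrow> continuous_on {0..T} v \<and> v T = 0 \<and>
     (\<forall>x\<in>D. \<forall>t\<in>{0..T}.
        cinner (v t) x =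
          (LINT s:{t<..<T}|lborel. cinner (v s) (A x) - obs_adjoint Obs (g s) x))"

text \<open>The control operator \<open>W\<^sup>s g = v\<^sup>g(s)\<close>.\<close>

definition control_op ::
    "'a set \<Rightarrow> ('a::complex_hilbert \<Rightarrow> 'a) \<Rightarrow> ('a \<Rightarrow> complex) \<Rightarrow> real \<Rightarrow> real \<Rightarrow>
     (real \<Rightarrow> complex) \<Rightarrow> 'a" where
  "control_op D A Obs T s g = (THE w. \<exists>v. backward_solution D A Obs T g v \<and> v s = w)"

lemma obs_adjoint_eq:
  assumes "\<And>x c. x \<in> D \<Longrightarrow> cinner (Obs x) c = cinner x (B c)" and "x \<in> D"
  shows "obs_adjoint Obs c x = cinner (B c) x"
  using assms by (metis cinner_commute obs_adjoint_def)

lemma observation_bounded: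
  assumes "bounded_linear Obs" and "continuous_on {0..} u"
    and "\<And>t. t \<in> {0<..<S} \<Longrightarrow> y t = Obs (u t)"
  shows "is_observation Obs S u y"
proof -
  have cont: "continuous_on {0..t} (\<lambda>s. Obs (u s))" for t
    using assms(1,2) by (auto intro: bounded_linear.continuous_on continuous_on_subset)
  have int: "set_integrable lborel {0<..<t} (\<lambda>s. Obs (u s))"
    and sq: "set_integrable lborel {0<..<t} (\<lambda>s. (cmod (Obs (u s)))\<^sup>2)" for t
    by (rule set_integrable_subset[of _ "{0..t}"],
        auto intro!: borel_integrable_atLeastAtMost' continuous_intros cont)+
  have meas: "set_borel_measurable lborel {0<..<S} y"
    using int[of S] assms(3) unfolding set_integrable_def set_borel_measurable_def
    by (subst measurable_cong[where g = "\<lambda>s. indicator {0<..<S} s *\<^sub>R Obs (u s)"])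
      (auto simp: indicator_def dest: borel_measurable_integrable)
  have "set_integrable lborel {0<..<S} (\<lambda>t. (cmod (y t))\<^sup>2)"
    using sq[of S] assms(3) by (subst set_integrable_cong[OF refl refl]) auto
  moreover have "Obs (integral {0..t} u) = (LINT s:{0<..<t}|lborel. y s)" if "t \<in> {0..S}" for t
  proof -
    have "u integrable_on {0..t}"
      using assms(2) by (intro integrable_continuous_interval) (auto intro: continuous_on_subset)
    then have "Obs (integral {0..t} u) = integral {0..t} (\<lambda>s. Obs (u s))"
      by (simp add: integral_linear[OF _ assms(1), unfolded o_def])
    also have "\<dots> = integral {0<..<t} (\<lambda>s. Obs (u s))"
      by (simp add: integral_open_interval_real)
    also have "\<dots> = (LINT s:{0<..<t}|lborel. Obs (u s))"
      using set_borel_integral_eq_integral(2)[OF int] by simp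
    also have "\<dots> = (LINT s:{0<..<t}|lborel. y s)"
      using assms(3) that by (intro set_lebesgue_integral_cong) auto
    finally show ?thesis .
  qed
  ultimately show ?thesis
    using meas by (simp add: is_observation_def L2_on_def)
qed


section \<open>The generalized spectral problem\<close>

text \<open>The integrals over \<open>(0, 2T)\<close> of \<open>(y(t), f(t - T + \<tau>))\<close> and of \<open>(y'(t), f(t - T + \<tau>))\<close>. The
  latter is defined by integration by parts: \<open>t \<mapsto> f(t - T + \<tau>)\<close> vanishes at both end points.\<close>

definition data_form ::
    "(real \<Rightarrow> complex) \<Rightarrow> real \<Rightarrow> (real \<Rightarrow> complex) \<Rightarrow> real \<Rightarrow> complex" where
  "data_form y T f \<tau> = (LINT t:{0<..<2*T}|lborel. cinner (y t) (f (t - T + \<tau>)))"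

definition data_deriv_form ::
    "(real \<Rightarrow> complex) \<Rightarrow> real \<Rightarrow> (real \<Rightarrow> complex) \<Rightarrow> real \<Rightarrow> complex" where
  "data_deriv_form y T f \<tau> =
     - (LINT t:{0<..<2*T}|lborel. cinner (y t) (wderiv T f (t - T + \<tau>)))"

text \<open>The controls whose data form vanishes identically. They satisfy the equation of the spectral
  problem for every \<open>\<lambda>\<close>, whatever the system is; for a generic source they are the \<open>f\<close> with
  \<open>W\<^sup>0 f = 0\<close>, and in general they need not be zero.\<close>

definition silent :: "(real \<Rightarrow> complex) \<Rightarrow> real \<Rightarrow> (real \<Rightarrow> complex) set" where
  "silent y T = {f \<in> H01 T. \<forall>\<tau>\<in>{0<..<T}. data_form y T f \<tau> = 0}"

text \<open>\<open>Z\<close> is the set of controls that do not count as nonzero: \<open>{\<lambda>_. 0}\<close> gives the problem for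
  nonzero \<open>f\<close>, \<open>silent y T\<close> the problem modulo silent controls.\<close>

definition gen_spectrum ::
    "(real \<Rightarrow> complex) \<Rightarrow> real \<Rightarrow> (real \<Rightarrow> complex) set \<Rightarrow> complex set" where
  "gen_spectrum y T Z = {\<mu>. \<exists>f\<in>H01 T. f \<notin> Z \<and>
     (\<forall>\<tau>\<in>{0<..<T}. data_deriv_form y T f \<tau> - \<mu> * data_form y T f \<tau> = 0)}"

text \<open>The chain \<open>F 1, \<dots>, F M\<close>, with the convention \<open>F (M + 1) = 0\<close> and eigenvector \<open>F M\<close>.\<close>

definition gen_root_chain ::
    "(real \<Rightarrow> complex) \<Rightarrow> real \<Rightarrow> (real \<Rightarrow> complex) set \<Rightarrow> complex \<Rightarrow> nat \<Rightarrow>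
     (nat \<Rightarrow> real \<Rightarrow> complex) \<Rightarrow> bool" where
  "gen_root_chain y T Z \<mu> M F \<longleftrightarrow> 1 \<le> M \<and> F M \<notin> Z \<and> (\<forall>i\<in>{1..M}. F i \<in> H01 T \<and>
     (\<forall>\<tau>\<in>{0<..<T}. data_deriv_form y T (F i) \<tau> - \<mu> * data_form y T (F i) \<tau> =
        (if i < M then data_form y T (F (i + 1)) \<tau> else 0)))"

definition gen_root_vectors ::
    "(real \<Rightarrow> complex) \<Rightarrow> real \<Rightarrow> (real \<Rightarrow> complex) set \<Rightarrow> complex \<Rightarrow> (real \<Rightarrow> complex) set" where
  "gen_root_vectors y T Z \<mu> = {g. \<exists>M F. gen_root_chain y T Z \<mu> M F \<and> g \<in> F ` {1..M}}"

end

theory Submission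
  imports Defs
begin

text \<open>The spectral equation for controls is the root vector equation of \<open>A\<^sup>*\<close> in disguise. Let \<open>W f\<close>
  be the value at time \<open>0\<close> of the solution of the control system with control \<open>f\<close>. Two facts
  translate the data into operator terms. First, by duality between observation and control, the
  product in \<open>L\<^sub>2\<close> of the shifted observation \<open>y(\<cdot> + r)\<close> with \<open>f\<close> is \<open>- (u(r), W f)\<close>
  (\<open>correlation_obs\<close>). Second, a control that vanishes at both ends may be differentiated, and
  \<open>W f' = - A\<^sup>* W f\<close> (\<open>W_wderiv\<close>). Hence, with \<open>r = T - \<tau>\<close>, the difference of the two sides
  of the chain equation for \<open>F\<close> with right-hand side \<open>G\<close> is
  \<open>- (u(r), (A\<^sup>* - cnj \<mu>) W F - W G)\<close>.

  The points \<open>u(r)\<close>, \<open>0 < r < T\<close>, of the trajectory of a generic source are total in the Hilbert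
  space (\<open>trajectory_complete\<close>). So the equation holds for all \<open>\<tau>\<close> iff
  \<open>(A\<^sup>* - cnj \<mu>) W F = W G\<close>, and the silent controls are those with \<open>W f = 0\<close>. Chains for \<open>\<mu>\<close>
  modulo silent controls are therefore the chains of \<open>A\<^sup>*\<close> at \<open>cnj \<mu>\<close> formed by values of \<open>W\<close>, and
  since \<open>W (f k i) = \<psi> k i\<close>, every member of such a chain is, up to a silent control, a
  combination of the given controls.

  Totality on a time interval as short as \<open>(0, T)\<close> is where spectral controllability enters.
  Testing the controls with the explicit solutions that start from root vectors shows that
  \<open>f k i\<close> is orthogonal to the functions \<open>t\<^sup>m exp (\<lambda> t)\<close>, \<open>m\<close> below the multiplicity, of every other
  eigenvalue \<open>\<lambda>\<close> and to the first \<open>i - 1\<close> of those of \<open>lam k\<close> (\<open>moment_f\<close>). Thus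
  the mean of the trajectory with weight \<open>cnj (f k i)\<close>
  is a combination of \<open>\<phi> k 1, \<dots>, \<phi> k (L k - i + 1)\<close> whose last coefficient is a nonzero multiple of
  the coefficient \<open>c k (L k)\<close> of the source, and these means span all root vectors.

  The adjoint is never applied to \<open>W F\<close>: all equations are tested against the total family \<open>\<phi>\<close>,
  that is, written in the coordinates \<open>(\<phi> k j, W F)\<close>, where they become the recursion of
  \<open>chain_equation_iff\<close>. What remains is elementary algebra with these coordinates.\<close>

section \<open>Complex Hilbert spaces\<close>

lemma cinner_add_right: "cinner x (y + z) = cinner x y + cinner x z"
  by (metis cinner_add_left cinner_commute complex_cnj_add)

lemma cinner_scaleC_right: "cinner x (c *\<^sub>C y) = cnj c * cinner x y"
  by (metis cinner_scaleC_left cinner_commute complex_cnj_mult)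

lemma cinner_self: "cinner x x = of_real ((norm x)\<^sup>2)"
proof -
  have "Re (cinner x x) = (norm x)\<^sup>2"
    by (metis inner_eq_Re_cinner power2_norm_eq_inner)
  moreover have "Im (cinner x x) = 0"
    using cinner_commute[of x x] by (metis Reals_cnj_iff complex_is_Real_iff)
  ultimately show ?thesis
    by (simp add: complex_eq_iff)
qed

lemma norm_scaleC: "norm (c *\<^sub>C x) = cmod c * norm x"
proof -
  have "of_real ((norm (c *\<^sub>C x))\<^sup>2) = c * cnj c * of_real ((norm x)\<^sup>2)"
    by (simp only: cinner_self[symmetric]) (simp add: cinner_scaleC_left cinner_scaleC_right)
  also have "\<dots> = of_real ((cmod c * norm x)\<^sup>2)"
    by (simp add: complex_norm_square[symmetric] power_mult_distrib)
  finally have "(norm (c *\<^sub>C x))\<^sup>2 = (cmod c * norm x)\<^sup>2"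
    using of_real_eq_iff by blast
  then show ?thesis
    by (simp add: power2_eq_iff_nonneg)
qed

lemma cmod_cinner_le: "cmod (cinner x y) \<le> norm x * norm y"
proof (cases "cinner x y = 0")
  case False
  \<comment> \<open>Rotate \<open>x\<close> so that the product becomes real; then it is a real inner product.\<close>
  define c where "c = cnj (sgn (cinner x y))"
  have c: "cmod c = 1"
    using False by (simp add: c_def norm_sgn)
  have "c * cinner x y = cmod (cinner x y)"
    using False unfolding c_def
    by (simp add: sgn_eq complex_norm_square[symmetric] power2_eq_square mult.commute)
  then have "cmod (cinner x y) = (c *\<^sub>C x) \<bullet> y"
    by (simp add: inner_eq_Re_cinner cinner_scaleC_left)
  also have "\<dots> \<le> norm (c *\<^sub>C x) * norm y"
    by (rule norm_cauchy_schwarz)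
  finally show ?thesis
    by (simp add: norm_scaleC c)
qed auto

lemma bounded_bilinear_cinner: "bounded_bilinear cinner"
proof
  show "cinner (r *\<^sub>R x) y = r *\<^sub>R cinner x y" for r and x y :: 'a
    by (simp add: scaleC_of_real[symmetric, of r x] cinner_scaleC_left scaleR_conv_of_real)
  show "cinner x (r *\<^sub>R y) = r *\<^sub>R cinner x y" for r and x y :: 'a
    by (simp add: scaleC_of_real[symmetric, of r y] cinner_scaleC_right scaleR_conv_of_real)
  show "\<exists>K. \<forall>x y :: 'a. cmod (cinner x y) \<le> norm x * norm y * K"
    by (metis cmod_cinner_le mult.right_neutral)
qed (simp_all add: cinner_add_left cinner_add_right)

lemma bounded_bilinear_scaleC: "bounded_bilinear scaleC"
proof
  show "(r *\<^sub>R c) *\<^sub>C x = r *\<^sub>R c *\<^sub>C x" for r c and x :: 'a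
    by (metis scaleC_of_real scaleC_scaleC scaleR_conv_of_real)
  show "c *\<^sub>C (r *\<^sub>R x) = r *\<^sub>R c *\<^sub>C x" for r c and x :: 'a
    by (metis mult.commute scaleC_of_real scaleC_scaleC)
  show "\<exists>K. \<forall>c (x :: 'a). norm (c *\<^sub>C x) \<le> norm c * norm x * K"
    by (metis norm_scaleC order.refl mult.right_neutral)
qed (simp_all add: scaleC_add_left scaleC_add_right)

interpretation cinner: bounded_bilinear cinner
  by (rule bounded_bilinear_cinner)

interpretation scaleC: bounded_bilinear scaleC
  by (rule bounded_bilinear_scaleC)

lemma eq_0_if_orthogonal_to_total:
  assumes total: "closure (complex_vector.span E) = UNIV"
    and orth: "\<And>e. e \<in> E \<Longrightarrow> cinner e x = 0"
  shows "x = 0"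
proof -
  have "cinner z x = 0" if "z \<in> complex_vector.span E" for z
    using that
    by (induction rule: complex_vector.span_induct_alt)
       (auto simp: cinner.zero_left cinner_add_left cinner_scaleC_left orth)
  moreover have "closed {z. cinner z x = 0}"
    by (intro closed_Collect_eq continuous_intros cinner.continuous_on)
  ultimately have "closure (complex_vector.span E) \<subseteq> {z. cinner z x = 0}"
    by (intro closure_minimal) auto
  then have "cinner x x = 0"
    using total by auto
  then show ?thesis
    by (simp add: cinner_self)
qed

section \<open>Correlation of square integrable functions\<close>

definition sq_integrable :: "(real \<Rightarrow> complex) \<Rightarrow> bool" where
  "sq_integrable h \<longleftrightarrow> h \<in> borel_measurable borel \<and> integrable lborel (\<lambda>s. (cmod (h s))\<^sup>2)"

text \<open>The weight \<open>e\<close> replaces the Cauchy-Schwarz inequality for integrals: the first term of the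
  bound is made small by the choice of \<open>e\<close>, then the second by the choice of \<open>b\<close>.\<close>

lemma cmod_mult_le_weighted:
  fixes a b :: complex
  assumes "e > 0"
  shows "cmod (a * b) \<le> e * (cmod a)\<^sup>2 + (cmod b)\<^sup>2 / e"
proof -
  have "0 \<le> (e * cmod a - cmod b)\<^sup>2 + (e * cmod a)\<^sup>2 + (cmod b)\<^sup>2"
    by simp
  then have "2 * (e * (cmod a * cmod b)) \<le> 2 * ((e * cmod a)\<^sup>2 + (cmod b)\<^sup>2)"
    by (simp add: power2_diff algebra_simps)
  then have "cmod a * cmod b \<le> ((e * cmod a)\<^sup>2 + (cmod b)\<^sup>2) / e"
    using assms by (simp add: field_simps)
  also have "\<dots> = e * (cmod a)\<^sup>2 + (cmod b)\<^sup>2 / e"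
    using assms by (simp add: field_simps power2_eq_square)
  finally show ?thesis
    by (simp add: norm_mult)
qed

lemma sq_integrable_shift:
  assumes "sq_integrable h"
  shows "sq_integrable (\<lambda>s. h (s + r))"
  using assms lborel_integrable_real_affine[of "\<lambda>s. (cmod (h s))\<^sup>2" 1 r]
  unfolding sq_integrable_def by (auto simp: add.commute)

lemma integral_sq_shift:
  fixes h :: "real \<Rightarrow> complex"
  shows
  "(\<integral>s. (cmod (h (s + r)))\<^sup>2 \<partial>lborel) = (\<integral>s. (cmod (h s))\<^sup>2 \<partial>lborel)"
  using lborel_integral_real_affine[of 1 "\<lambda>s. (cmod (h s))\<^sup>2" r] by (simp add: add.commute)

lemma sq_integrable_mult:
  assumes "sq_integrable y" "sq_integrable h"
  shows "integrable lborel (\<lambda>s. y s * h s)"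
proof (rule Bochner_Integration.integrable_bound)
  show "integrable lborel (\<lambda>s. (cmod (y s))\<^sup>2 + (cmod (h s))\<^sup>2)"
    using assms by (auto simp: sq_integrable_def)
  show "(\<lambda>s. y s * h s) \<in> borel_measurable lborel"
    using assms by (auto simp: sq_integrable_def)
  show "AE s in lborel. norm (y s * h s) \<le> norm ((cmod (y s))\<^sup>2 + (cmod (h s))\<^sup>2)"
    using cmod_mult_le_weighted[of 1] by auto
qed

lemma sq_integrable_diff:
  assumes "sq_integrable g" "sq_integrable h"
  shows "sq_integrable (\<lambda>s. g s - h s)"
proof -
  have "integrable lborel (\<lambda>s. (cmod (g s - h s))\<^sup>2)"
  proof (rule Bochner_Integration.integrable_bound)
    show "integrable lborel (\<lambda>s. 2 * (cmod (g s))\<^sup>2 + 2 * (cmod (h s))\<^sup>2)"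
      using assms by (auto simp: sq_integrable_def)
    show "(\<lambda>s. (cmod (g s - h s))\<^sup>2) \<in> borel_measurable lborel"
      using assms by (auto simp: sq_integrable_def)
    have "(cmod (a - b))\<^sup>2 \<le> 2 * (cmod a)\<^sup>2 + 2 * (cmod b)\<^sup>2" for a b
    proof -
      have "(cmod (a - b))\<^sup>2 \<le> (cmod a + cmod b)\<^sup>2"
        by (simp add: norm_triangle_ineq4 power_mono)
      also have "\<dots> \<le> 2 * (cmod a)\<^sup>2 + 2 * (cmod b)\<^sup>2"
        using sum_squares_bound[of "cmod a" "cmod b"] by (simp add: power2_sum)
      finally show ?thesis .
    qed
    then show "AE s in lborel. norm ((cmod (g s - h s))\<^sup>2)
        \<le> norm (2 * (cmod (g s))\<^sup>2 + 2 * (cmod (h s))\<^sup>2)"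
      by auto
  qed
  then show ?thesis
    using assms by (auto simp: sq_integrable_def)
qed

lemma sq_integrable_cnj: "sq_integrable h \<Longrightarrow> sq_integrable (\<lambda>s. cnj (h s))"
  unfolding sq_integrable_def
  by (auto intro!: measurable_compose[of h _ borel cnj] borel_measurable_continuous_onI[of cnj]
      continuous_on_cnj[OF continuous_on_id])

definition correlation :: "(real \<Rightarrow> complex) \<Rightarrow> (real \<Rightarrow> complex) \<Rightarrow> real \<Rightarrow> complex" where
  "correlation y h r = (\<integral>s. y (s + r) * h s \<partial>lborel)"

text \<open>Approximation in \<open>L\<^sub>2\<close> of the second factor is uniform in the shift.\<close>

lemma correlation_continuous_limit:
  assumes y: "sq_integrable y" and h: "sq_integrable h" and g: "\<And>n. sq_integrable (g n)"
    and lim: "(\<lambda>n. \<integral>s. (cmod (g n s - h s))\<^sup>2 \<partial>lborel) \<longlonglongrightarrow> 0"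
    and cont: "\<And>n. continuous_on UNIV (correlation y (g n))"
  shows "continuous_on UNIV (correlation y h)"
proof (rule uniform_limit_theorem)
  let ?C = "\<integral>s. (cmod (y s))\<^sup>2 \<partial>lborel"
  show "\<forall>\<^sub>F n in sequentially. continuous_on UNIV (correlation y (g n))"
    using cont by simp
  have C: "?C \<ge> 0"
    by simp
  show "uniform_limit UNIV (\<lambda>n. correlation y (g n)) (correlation y h) sequentially"
  proof (rule uniform_limitI)
    fix e :: real assume e: "e > 0"
    \<comment> \<open>The weight for which the term with \<open>y\<close>, uniformly in the shift, is below \<open>e / 2\<close>.\<close>
    define d where "d = e / (2 * (?C + 1))"
    have d: "d > 0" and dC: "d * ?C < e / 2"
      using e C by (auto simp: d_def field_simps add_pos_nonneg intro!: divide_pos_pos)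
    have "\<forall>\<^sub>F n in sequentially. (\<integral>s. (cmod (g n s - h s))\<^sup>2 \<partial>lborel) < d * (e / 2)"
      using lim d e by (intro order_tendstoD) auto
    then show "\<forall>\<^sub>F n in sequentially. \<forall>r\<in>UNIV. dist (correlation y (g n) r) (correlation y h r) < e"
    proof (eventually_elim, safe)
      fix n r assume n: "(\<integral>s. (cmod (g n s - h s))\<^sup>2 \<partial>lborel) < d * (e / 2)"
      have ys: "sq_integrable (\<lambda>s. y (s + r))" and gh: "sq_integrable (\<lambda>s. g n s - h s)"
        using sq_integrable_shift y sq_integrable_diff g h by auto
      have "correlation y (g n) r - correlation y h r = (\<integral>s. y (s + r) * (g n s - h s) \<partial>lborel)"
        unfolding correlation_def
        by (subst Bochner_Integration.integral_diff[symmetric])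
           (auto intro!: sq_integrable_mult ys g h simp: algebra_simps)
      also have "cmod \<dots> \<le> (\<integral>s. d * (cmod (y (s + r)))\<^sup>2 + (cmod (g n s - h s))\<^sup>2 / d \<partial>lborel)"
        using ys gh cmod_mult_le_weighted[OF d]
        by (intro Bochner_Integration.integral_norm_bound_integral sq_integrable_mult)
           (auto simp: sq_integrable_def)
      also have "\<dots> = d * ?C + (\<integral>s. (cmod (g n s - h s))\<^sup>2 \<partial>lborel) / d"
        using ys gh integral_sq_shift[of y r]
        by (subst Bochner_Integration.integral_add) (auto simp: sq_integrable_def)
      also have "\<dots> < e / 2 + e / 2"
        using n d by (intro add_strict_mono dC) (simp add: field_simps)
      finally show "dist (correlation y (g n) r) (correlation y h r) < e"
        by (simp add: dist_norm)
    qed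
  qed
qed simp

lemma sq_integrable_dominated:
  assumes h: "sq_integrable h" and g: "g \<in> borel_measurable borel"
    and "\<And>s. cmod (g s) \<le> cmod (h s)"
  shows "sq_integrable g"
  unfolding sq_integrable_def
proof
  show "integrable lborel (\<lambda>s. (cmod (g s))\<^sup>2)"
    by (rule Bochner_Integration.integrable_bound[of _ "\<lambda>s. (cmod (h s))\<^sup>2"])
       (use assms in \<open>auto simp: sq_integrable_def power_mono\<close>)
qed fact

lemma sq_integrable_bounded_support:
  assumes "g \<in> borel_measurable borel" and bound: "\<And>s. cmod (g s) \<le> B"
    and supp: "\<And>s. s \<notin> {a..b} \<Longrightarrow> g s = 0"
  shows "sq_integrable g"
  unfolding sq_integrable_def
proof
  show "integrable lborel (\<lambda>s. (cmod (g s))\<^sup>2)"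
  proof (rule Bochner_Integration.integrable_bound[of _ "\<lambda>s. indicator {a..b} s *\<^sub>R B\<^sup>2"])
    show "integrable lborel (\<lambda>s. indicator {a..b} s *\<^sub>R B\<^sup>2)"
      by (intro integrable_scaleR_left integrable_real_indicator) (auto simp: emeasure_lborel_Icc_eq)
    have "(cmod (g s))\<^sup>2 \<le> indicator {a..b} s * B\<^sup>2" for s
      using supp[of s] bound[of s] by (cases "s \<in> {a..b}") (auto simp: power_mono)
    then show "AE s in lborel. norm ((cmod (g s))\<^sup>2) \<le> norm (indicator {a..b} s *\<^sub>R B\<^sup>2)"
      by (auto simp: indicator_def abs_mult)
  qed (use assms in auto)
qed fact

lemma sq_integrable_imp_set_integrable:
  assumes "sq_integrable h"
  shows "set_integrable lborel {a..b} h"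
proof -
  have "sq_integrable (\<lambda>s. of_real (indicator {a..b} s))"
    by (rule sq_integrable_bounded_support[of _ 1 a b]) (auto simp: indicator_def)
  from sq_integrable_mult[OF this assms] show ?thesis
    unfolding set_integrable_def by (simp add: scaleR_conv_of_real)
qed

lemma correlation_continuous_kernel:
  assumes y: "sq_integrable y" and g: "continuous_on UNIV g"
    and bound: "\<And>s. cmod (g s) \<le> B" and supp: "\<And>s. s \<notin> {a..b} \<Longrightarrow> g s = 0"
  shows "continuous_on UNIV (correlation y g)"
proof (rule continuous_on_sequentiallyI)
  fix R r assume R: "R \<longlonglongrightarrow> (r :: real)"
  have corr: "correlation y g q = (\<integral>t. y t * g (t - q) \<partial>lborel)" for q
    unfolding correlation_def
    using lborel_integral_real_affine[of 1 "\<lambda>t. y t * g (t - q)" q] by (simp add: add.commute)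
  obtain N where N: "\<And>n. \<bar>R n\<bar> \<le> N"
    using R by (metis convergentI convergent_imp_Bseq Bseq_def real_norm_def)
  have B: "B \<ge> 0"
    using bound[of 0] norm_ge_zero order_trans by blast
  have ym [measurable]: "y \<in> borel_measurable borel" and gm [measurable]: "g \<in> borel_measurable borel"
    using y g by (auto simp: sq_integrable_def intro: borel_measurable_continuous_onI)
  show "(\<lambda>n. correlation y g (R n)) \<longlonglongrightarrow> correlation y g r"
    unfolding corr
  proof (rule integral_dominated_convergence[where w = "\<lambda>t. B * norm (indicator {a-N..b+N} t *\<^sub>R y t)"])
    show "integrable lborel (\<lambda>t. B * norm (indicator {a-N..b+N} t *\<^sub>R y t))"
      using sq_integrable_imp_set_integrable[OF y, of "a-N" "b+N"]
      unfolding set_integrable_def by (intro integrable_mult_right integrable_norm)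
    show "AE t in lborel. (\<lambda>n. y t * g (t - R n)) \<longlonglongrightarrow> y t * g (t - r)"
    proof (intro AE_I2 tendsto_mult tendsto_const)
      fix t
      have "isCont g (t - r)"
        using g by (simp add: continuous_on_eq_continuous_at)
      then show "(\<lambda>n. g (t - R n)) \<longlonglongrightarrow> g (t - r)"
        by (rule isCont_tendsto_compose) (intro tendsto_intros R)
    qed
    show "AE t in lborel. norm (y t * g (t - R n)) \<le> B * norm (indicator {a-N..b+N} t *\<^sub>R y t)" for n
    proof (intro AE_I2)
      fix t
      show "norm (y t * g (t - R n)) \<le> B * norm (indicator {a-N..b+N} t *\<^sub>R y t)"
      proof (cases "t \<in> {a-N..b+N}")
        case True
        then show ?thesis
          using mult_right_mono[OF bound[of "t - R n"] norm_ge_zero[of "y t"]]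
          by (simp add: norm_mult mult.commute)
      next
        case False
        then have "t - R n \<notin> {a..b}"
          using N[of n] by auto
        then show ?thesis
          using supp False by simp
      qed
    qed
  qed measurable
qed

text \<open>Measurable functions are almost everywhere limits of continuous ones. Clipping these to a disc
  and cutting them off outside a compact interval does not disturb the limit if it is bounded and
  supported there, and it makes the convergence dominated.\<close>

lemma correlation_continuous_bounded:
  assumes y: "sq_integrable y" and h: "h \<in> borel_measurable borel"
    and bound: "\<And>s. cmod (h s) \<le> B" and supp: "\<And>s. s \<notin> {a..b} \<Longrightarrow> h s = 0"
    and B: "B > 0"
  shows "continuous_on UNIV (correlation y h)"
proof -
  have "h \<in> borel_measurable (lebesgue_on UNIV)"
    using h by (simp add: borel_measurable_if_D lebesgue_on_UNIV_eq measurable_completion)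
  then have "h measurable_on UNIV"
    by (simp add: lebesgue_measurable_imp_measurable_on lebesgue_on_UNIV_eq)
  then obtain N g where N: "negligible N" and g: "\<And>n. continuous_on UNIV (g n)"
    and lim: "\<And>s. s \<notin> N \<Longrightarrow> (\<lambda>n. g n s) \<longlonglongrightarrow> h s"
    unfolding measurable_on_def by (auto simp del: split_paired_Ex)
  define clip where "clip z = of_real (B / max B (cmod z)) * z" for z :: complex
  define cutoff where "cutoff s = max 0 (1 - infdist s {a..b})" for s :: real
  define G where "G n s = of_real (cutoff s) * clip (g n s)" for n s
  have clip_cont: "continuous_on UNIV clip"
    unfolding clip_def using B by (intro continuous_intros) (auto simp: max_def)
  have clip_bound: "cmod (clip z) \<le> B" for z
  proof -
    have "cmod (clip z) = B * (cmod z / max B (cmod z))"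
      using B by (simp add: clip_def norm_mult norm_divide)
    also have "\<dots> \<le> B * 1"
      using B by (intro mult_left_mono) (auto simp: field_simps max_def)
    finally show ?thesis by simp
  qed
  have clip_h: "clip (h s) = h s" for s
    using bound[of s] B by (simp add: clip_def max_def)
  have cutoff: "0 \<le> cutoff s" "cutoff s \<le> 1" for s
    by (auto simp: cutoff_def infdist_nonneg)
  have cutoff_in: "cutoff s = 1" if "s \<in> {a..b}" for s
    using that by (simp add: cutoff_def)
  have cutoff_out: "cutoff s = 0" if "s \<notin> {a-1..b+1}" "a \<le> b" for s
  proof -
    have "infdist s {a..b} \<ge> 1"
      unfolding infdist_def using that
      by (auto simp: dist_real_def intro!: cINF_greatest)
    then show ?thesis by (simp add: cutoff_def)
  qed
  show ?thesis
  proof (cases "a \<le> b")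
    case False
    then have "h = (\<lambda>_. 0)"
      using supp by auto
    then show ?thesis
      by (simp add: correlation_def)
  next
    case ab: True
    have cutoff_h: "of_real (cutoff s) * h s = h s" for s
      using supp[of s] cutoff_in[of s] by (cases "s \<in> {a..b}") auto
    have G_cont: "continuous_on UNIV (G n)" for n
      unfolding G_def cutoff_def
      by (intro continuous_intros continuous_on_compose2[OF clip_cont g]) auto
    have G_bound: "cmod (G n s) \<le> B" for n s
      using mult_mono[OF cutoff(2)[of s] clip_bound[of "g n s"]] cutoff(1)[of s]
      by (simp add: G_def norm_mult)
    have G_supp: "G n s = 0" if "s \<notin> {a-1..b+1}" for n s
      using cutoff_out[OF that ab] by (simp add: G_def)
    have h_supp: "h s = 0" if "s \<notin> {a-1..b+1}" for s
      using supp[of s] that by auto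
    have G_meas: "G n \<in> borel_measurable borel" for n
      using G_cont by (rule borel_measurable_continuous_onI)
    have G_sq: "sq_integrable (G n)" for n
      by (rule sq_integrable_bounded_support[OF G_meas G_bound G_supp])
    have h_sq: "sq_integrable h"
      by (rule sq_integrable_bounded_support[OF h bound supp])
    show ?thesis
    proof (rule correlation_continuous_limit[OF y h_sq G_sq])
      show "continuous_on UNIV (correlation y (G n))" for n
        by (rule correlation_continuous_kernel[OF y G_cont G_bound G_supp])
      have "(\<lambda>n. \<integral>s. (cmod (G n s - h s))\<^sup>2 \<partial>lborel) \<longlonglongrightarrow> (\<integral>s. 0 \<partial>(lborel :: real measure))"
      proof (rule integral_dominated_convergence[where w = "\<lambda>s. indicator {a-1..b+1} s *\<^sub>R (2 * B)\<^sup>2"])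
        show "integrable lborel (\<lambda>s. indicator {a-1..b+1} s *\<^sub>R (2 * B)\<^sup>2)"
          by (intro integrable_scaleR_left integrable_real_indicator) (auto simp: emeasure_lborel_Icc_eq)
        have "AE s in lebesgue. s \<notin> N"
          using N by (simp add: AE_not_in negligible_iff_null_sets)
        then have "AE s in lborel. s \<notin> N"
          using AE_completion_iff by blast
        then show "AE s in lborel. (\<lambda>n. (cmod (G n s - h s))\<^sup>2) \<longlonglongrightarrow> 0"
        proof eventually_elim
          case (elim s)
          have "isCont clip (h s)"
            using clip_cont by (simp add: continuous_on_eq_continuous_at)
          then have "(\<lambda>n. clip (g n s)) \<longlonglongrightarrow> clip (h s)"
            by (rule isCont_tendsto_compose) (rule lim[OF elim])
          then have "(\<lambda>n. G n s - h s) \<longlonglongrightarrow> of_real (cutoff s) * clip (h s) - h s"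
            unfolding G_def by (intro tendsto_intros)
          then have "(\<lambda>n. G n s - h s) \<longlonglongrightarrow> 0"
            by (simp add: clip_h cutoff_h)
          then show ?case
            using tendsto_power[OF tendsto_norm, of "\<lambda>n. G n s - h s" 0 _ 2] by simp
        qed
        show "AE s in lborel. norm ((cmod (G n s - h s))\<^sup>2) \<le> indicator {a-1..b+1} s *\<^sub>R (2 * B)\<^sup>2" for n
        proof (rule AE_I2)
          fix s
          show "norm ((cmod (G n s - h s))\<^sup>2) \<le> indicator {a-1..b+1} s *\<^sub>R (2 * B)\<^sup>2"
          proof (cases "s \<in> {a-1..b+1}")
            case True
            have "cmod (G n s - h s) \<le> 2 * B"
              using norm_triangle_ineq4[of "G n s" "h s"] G_bound[of n s] bound[of s] by linarith
            then show ?thesis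
              using True power_mono[of "cmod (G n s - h s)" "2 * B" 2] by simp
          qed (use G_supp h_supp in auto)
        qed
      qed (use G_meas h in auto)
      then show "(\<lambda>n. \<integral>s. (cmod (G n s - h s))\<^sup>2 \<partial>lborel) \<longlonglongrightarrow> 0"
        by simp
    qed
  qed
qed

theorem correlation_continuous:
  assumes y: "sq_integrable y" and h: "sq_integrable h"
  shows "continuous_on UNIV (correlation y h)"
proof -
  define g where "g n s = (if \<bar>s\<bar> \<le> real n \<and> cmod (h s) \<le> real n then h s else 0)" for n s
  have hm [measurable]: "h \<in> borel_measurable borel"
    using h by (simp add: sq_integrable_def)
  have gm [measurable]: "g n \<in> borel_measurable borel" for n
    unfolding g_def by measurable
  show ?thesis
  proof (rule correlation_continuous_limit[OF y h])
    show "sq_integrable (g n)" for n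
      by (rule sq_integrable_dominated[OF h gm]) (auto simp: g_def)
    show "continuous_on UNIV (correlation y (g n))" for n
      by (rule correlation_continuous_bounded[OF y gm, where B = "real n + 1" and a = "- real n" and b = "real n"])
         (auto simp: g_def)
    have "(\<lambda>n. \<integral>s. (cmod (g n s - h s))\<^sup>2 \<partial>lborel) \<longlonglongrightarrow> (\<integral>s. 0 \<partial>(lborel :: real measure))"
    proof (rule integral_dominated_convergence[where w = "\<lambda>s. (cmod (h s))\<^sup>2"])
      show "AE s in lborel. (\<lambda>n. (cmod (g n s - h s))\<^sup>2) \<longlonglongrightarrow> 0"
      proof (rule AE_I2)
        fix s
        have "\<forall>\<^sub>F n in sequentially. max \<bar>s\<bar> (cmod (h s)) \<le> real n"
          using filterlim_real_sequentially unfolding filterlim_at_top by blast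
        then have "\<forall>\<^sub>F n in sequentially. (cmod (g n s - h s))\<^sup>2 = 0"
          by eventually_elim (auto simp: g_def)
        then show "(\<lambda>n. (cmod (g n s - h s))\<^sup>2) \<longlonglongrightarrow> 0"
          by (rule tendsto_eventually)
      qed
      show "AE s in lborel. norm ((cmod (g n s - h s))\<^sup>2) \<le> (cmod (h s))\<^sup>2" for n
        by (auto simp: g_def)
      show "integrable lborel (\<lambda>s. (cmod (h s))\<^sup>2)"
        using h by (simp add: sq_integrable_def)
    qed measurable
    then show "(\<lambda>n. \<integral>s. (cmod (g n s - h s))\<^sup>2 \<partial>lborel) \<longlonglongrightarrow> 0"
      by simp
  qed
qed

text \<open>Fubini: averaging the correlation over shifts replaces the first factor by its
  integral over a moving window, which is defined pointwise even where \<open>y\<close> is not.\<close>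

lemma integral_correlation:
  assumes y: "sq_integrable y" and h: "sq_integrable h"
  shows "(LINT \<rho>:{a..b}|lborel. correlation y h \<rho>)
       = (\<integral>s. (LINT \<rho>:{a..b}|lborel. y (s + \<rho>)) * h s \<partial>lborel)"
proof -
  have [measurable]: "y \<in> borel_measurable borel" "h \<in> borel_measurable borel"
    using y h by (simp_all add: sq_integrable_def)
  let ?F = "\<lambda>\<rho> s. indicator {a..b} \<rho> *\<^sub>R (y (s + \<rho>) * h s)"
  let ?C = "(\<integral>s. (cmod (y s))\<^sup>2 \<partial>lborel) + (\<integral>s. (cmod (h s))\<^sup>2 \<partial>lborel)"
  have inner: "integrable lborel (\<lambda>s. y (s + \<rho>) * h s)" for \<rho>
    by (intro sq_integrable_mult sq_integrable_shift y h)
  have inner_bound: "(\<integral>s. cmod (y (s + \<rho>) * h s) \<partial>lborel) \<le> ?C" for \<rho>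
  proof -
    have "(\<integral>s. cmod (y (s + \<rho>) * h s) \<partial>lborel)
        \<le> (\<integral>s. (cmod (y (s + \<rho>)))\<^sup>2 + (cmod (h s))\<^sup>2 \<partial>lborel)"
      using sq_integrable_shift[OF y, of \<rho>] h cmod_mult_le_weighted[of 1]
      by (intro Bochner_Integration.integral_mono integrable_norm inner)
         (auto simp: sq_integrable_def)
    also have "\<dots> = ?C"
      using sq_integrable_shift[OF y, of \<rho>] h integral_sq_shift[of y \<rho>]
      by (subst Bochner_Integration.integral_add) (auto simp: sq_integrable_def)
    finally show ?thesis .
  qed
  have "integrable (lborel \<Otimes>\<^sub>M lborel) (case_prod ?F)"
  proof (rule lborel_pair.Fubini_integrable)
    show "case_prod ?F \<in> borel_measurable (lborel \<Otimes>\<^sub>M lborel)"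
      by measurable
    show "AE \<rho> in lborel. integrable lborel (\<lambda>s. case (\<rho>, s) of (\<rho>, s) \<Rightarrow> ?F \<rho> s)"
      by (auto intro!: integrable_scaleR_right inner)
    show "integrable lborel (\<lambda>\<rho>. \<integral>s. norm (case (\<rho>, s) of (\<rho>, s) \<Rightarrow> ?F \<rho> s) \<partial>lborel)"
    proof (rule Bochner_Integration.integrable_bound[of _ "\<lambda>\<rho>. indicator {a..b} \<rho> *\<^sub>R ?C"])
      show "integrable lborel (\<lambda>\<rho>. indicator {a..b} \<rho> *\<^sub>R ?C)"
        by (intro integrable_scaleR_left integrable_real_indicator) (auto simp: emeasure_lborel_Icc_eq)
      show "(\<lambda>\<rho>. \<integral>s. norm (case (\<rho>, s) of (\<rho>, s) \<Rightarrow> ?F \<rho> s) \<partial>lborel) \<in> borel_measurable lborel"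
        by measurable
      have "norm (\<integral>s. norm (?F \<rho> s) \<partial>lborel) \<le> norm (indicator {a..b} \<rho> *\<^sub>R ?C)" for \<rho>
        using inner_bound[of \<rho>] by (cases "\<rho> \<in> {a..b}") auto
      then show "AE \<rho> in lborel. norm (\<integral>s. norm (case (\<rho>, s) of (\<rho>, s) \<Rightarrow> ?F \<rho> s) \<partial>lborel)
          \<le> norm (indicator {a..b} \<rho> *\<^sub>R ?C)"
        by simp
    qed
  qed
  from lborel_pair.Fubini_integral[OF this]
  have "(\<integral>\<rho>. (\<integral>s. ?F \<rho> s \<partial>lborel) \<partial>lborel) = (\<integral>s. (\<integral>\<rho>. ?F \<rho> s \<partial>lborel) \<partial>lborel)"
    by (rule sym)
  moreover have "(\<integral>\<rho>. ?F \<rho> s \<partial>lborel) = (LINT \<rho>:{a..b}|lborel. y (s + \<rho>)) * h s" for s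
    unfolding set_lebesgue_integral_def
    by (subst integral_mult_left_zero[symmetric]) simp
  ultimately show ?thesis
    by (simp add: set_lebesgue_integral_def correlation_def)
qed

section \<open>Duality between the observed and the controlled system\<close>

lemma LINT_open_interval_eq_integral:
  fixes F :: "real \<Rightarrow> complex"
  assumes "set_integrable lborel {a..b} F"
  shows "(LINT s:{a<..<b}|lborel. F s) = integral {a..b} F"
proof -
  have "set_integrable lborel {a<..<b} F"
    using assms by (rule set_integrable_subset) auto
  then show ?thesis
    using set_borel_integral_eq_integral(2) integral_open_interval_real[of a b F] by metis
qed

lemma set_integrable_mult_continuous:
  fixes g :: "real \<Rightarrow> complex"
  assumes h: "sq_integrable h" and g: "continuous_on {a..b} g"
  shows "set_integrable lborel {a..b} (\<lambda>s. h s * g s)"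
proof -
  have "sq_integrable (\<lambda>s. indicator {a..b} s *\<^sub>R g s)"
  proof -
    obtain B where "\<And>s. s \<in> {a..b} \<Longrightarrow> cmod (g s) \<le> B"
      using compact_imp_bounded[OF compact_continuous_image[OF g compact_Icc]]
      unfolding bounded_iff by fastforce
    moreover have "(\<lambda>s. indicator {a..b} s *\<^sub>R g s) \<in> borel_measurable borel"
      using borel_measurable_continuous_on_indicator[OF _ g] by simp
    ultimately show ?thesis
      by (intro sq_integrable_bounded_support[of _ "max 0 B" a b])
         (auto simp: indicator_def le_max_iff_disj)
  qed
  from sq_integrable_mult[OF h this] show ?thesis
    unfolding set_integrable_def by simp
qed

lemma backward_solution_increment:
  assumes w: "backward_solution D A Obs T h w" and h: "sq_integrable h"
    and x: "x \<in> D" and st: "0 \<le> s" "s \<le> t" "t \<le> T"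
  shows "cinner (w t) x - cinner (w s) x
       = integral {s..t} (\<lambda>\<sigma>. h \<sigma> * cnj (Obs x) - cinner (w \<sigma>) (A x))"
proof -
  define F where "F \<sigma> = cinner (w \<sigma>) (A x) - h \<sigma> * cnj (Obs x)" for \<sigma>
  have wc: "continuous_on {0..T} w"
    using w by (simp add: backward_solution_def)
  have F: "set_integrable lborel {0..T} F"
    unfolding F_def
    by (intro set_integral_diff borel_integrable_atLeastAtMost' set_integrable_mult_continuous h
        continuous_intros cinner.continuous_on wc)
  have FH: "F integrable_on {0..T}"
    using F by (rule set_borel_integral_eq_integral)
  have val: "cinner (w r) x = integral {r..T} F" if "r \<in> {0..T}" for r
  proof -
    have "cinner (w r) x = (LINT \<sigma>:{r<..<T}|lborel. F \<sigma>)"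
      using w x that
      by (simp add: backward_solution_def F_def obs_adjoint_def cinner_complex_def)
    also have "\<dots> = integral {r..T} F"
      using that by (intro LINT_open_interval_eq_integral set_integrable_subset[OF F]) auto
    finally show ?thesis .
  qed
  have "F integrable_on {s..T}"
    using FH by (rule integrable_subinterval_real) (use st in auto)
  then have "integral {s..t} F + integral {t..T} F = integral {s..T} F"
    by (intro Henstock_Kurzweil_Integration.integral_combine) (use st in auto)
  then have "cinner (w t) x - cinner (w s) x = - integral {s..t} F"
    using val[of s] val[of t] st by (simp add: algebra_simps)
  also have "\<dots> = integral {s..t} (\<lambda>\<sigma>. - F \<sigma>)"
    by simp
  finally show ?thesis
    by (simp add: F_def)
qed

text \<open>Formally \<open>d/ds (w, X) = (Bh - A\<^sup>* w, X) + (w, A X) = (h, O X)\<close>. As \<open>w\<close> solves its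
  equation only weakly, against fixed elements of the domain, the product rule is replaced by an
  estimate of the increments: over short intervals they agree with those of the integral of
  \<open>(h, O X)\<close> up to an arbitrarily small multiple of the length of the interval plus the integral
  of \<open>\<bar>h\<bar>\<close>, and such bounds add up.\<close>

lemma duality:
  assumes w: "backward_solution D A Obs T h w" and h: "sq_integrable h" and T: "0 \<le> T"
    and X_dom: "\<And>s. s \<in> {0..T} \<Longrightarrow> X s \<in> D"
    and X_deriv: "\<And>s. s \<in> {0..T} \<Longrightarrow> (X has_vector_derivative A (X s)) (at s within {0..T})"
    and AX: "continuous_on {0..T} (\<lambda>s. A (X s))"
    and OX: "continuous_on {0..T} (\<lambda>s. Obs (X s))"
  shows "cinner (w 0) (X 0) = - integral {0..T} (\<lambda>s. h s * cnj (Obs (X s)))"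
proof -
  have wc: "continuous_on {0..T} w"
    using w by (simp add: backward_solution_def)
  define g where "g s = h s * cnj (Obs (X s))" for s
  define K where "K s = 1 + cmod (h s)" for s
  have g_int: "g integrable_on {0..T}"
    unfolding g_def
    by (intro set_borel_integral_eq_integral set_integrable_mult_continuous h continuous_on_cnj OX)
  have h_int: "h integrable_on {0..T}"
    by (intro set_borel_integral_eq_integral sq_integrable_imp_set_integrable h)
  have K_int: "K integrable_on {0..T}"
  proof -
    have "set_integrable lborel {0..T} (\<lambda>s. cmod (h s))"
      using sq_integrable_imp_set_integrable[OF h] by (rule set_integrable_norm)
    then show ?thesis
      unfolding K_def
      by (intro Henstock_Kurzweil_Integration.integrable_add set_borel_integral_eq_integral(1)
          integrable_const_ivl)
  qed
  define D1 where "D1 s t = cinner (w t) (X t) - cinner (w s) (X s) - integral {s..t} g" for s t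
  have small: "cmod (D1 0 T) \<le> e * integral {0..T} K" if e: "e > 0" for e
  proof -
    define P where "P s t \<longleftrightarrow> (0 \<le> s \<and> t \<le> T \<longrightarrow> cmod (D1 s t) \<le> e * integral {s..t} K)" for s t
    have "P 0 T"
    proof (rule Bolzano[OF T])
      fix p q r assume trans: "P p q" "P q r" "p \<le> q" "q \<le> r"
      show "P p r"
        unfolding P_def
      proof
        assume pr: "0 \<le> p \<and> r \<le> T"
        have "integral {p..q} g + integral {q..r} g = integral {p..r} g"
          by (intro Henstock_Kurzweil_Integration.integral_combine
              integrable_subinterval_real[OF g_int]) (use pr trans in auto)
        then have "D1 p r = D1 p q + D1 q r"
          by (simp add: D1_def algebra_simps)
        moreover have "integral {p..q} K + integral {q..r} K = integral {p..r} K"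
          by (intro Henstock_Kurzweil_Integration.integral_combine
              integrable_subinterval_real[OF K_int]) (use pr trans in auto)
        moreover have "cmod (D1 p q) \<le> e * integral {p..q} K" "cmod (D1 q r) \<le> e * integral {q..r} K"
          using pr trans by (auto simp: P_def)
        moreover have "e * (integral {p..q} K + integral {q..r} K)
            = e * integral {p..q} K + e * integral {q..r} K"
          by (rule distrib_left)
        ultimately show "cmod (D1 p r) \<le> e * integral {p..r} K"
          using norm_triangle_ineq[of "D1 p q" "D1 q r"] by simp
      qed
    next
      fix x assume "0 \<le> x" "x \<le> T"
      then have x: "x \<in> {0..T}"
        by simp
      have "continuous_on ({0..T} \<times> {0..T}) (\<lambda>(p, q). cinner (w p) (A (X q)))"
        unfolding case_prod_beta
        by (intro cinner.continuous_on continuous_on_compose2[OF wc continuous_on_fst]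
            continuous_on_compose2[OF AX continuous_on_snd] continuous_on_id) auto
      from this[unfolded continuous_on_iff, rule_format, of "(x, x)" "e / 2"] x e
      obtain d1 where d1: "d1 > 0" "\<And>z. z \<in> {0..T} \<times> {0..T} \<Longrightarrow> dist z (x, x) < d1 \<Longrightarrow>
          dist (case z of (p, q) \<Rightarrow> cinner (w p) (A (X q))) (cinner (w x) (A (X x))) < e / 2"
        by auto
      obtain d2 where d2: "d2 > 0" "\<And>z. z \<in> {0..T} \<Longrightarrow> dist z x < d2 \<Longrightarrow>
          dist (Obs (X z)) (Obs (X x)) < e / 2"
        using OX[unfolded continuous_on_iff, rule_format, of x "e / 2"] x e by auto
      \<comment> \<open>Half of \<open>d1\<close>, because both arguments of the product move away from \<open>x\<close>.\<close>
      define d where "d = min (d1 / 2) d2"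
      have d: "d > 0"
        using d1 d2 by (simp add: d_def)
      show "\<exists>d>0. \<forall>s t. s \<le> x \<and> x \<le> t \<and> t - s < d \<longrightarrow> P s t"
        unfolding P_def
      proof (intro exI conjI allI impI)
        show "d > 0" by fact
        fix s t assume st: "s \<le> x \<and> x \<le> t \<and> t - s < d" and 0: "0 \<le> s \<and> t \<le> T"
        have near: "dist (cinner (w p) (A (X q))) (cinner (w x) (A (X x))) < e / 2"
          if "p \<in> {s..t}" "q \<in> {s..t}" for p q
        proof -
          have "dist (p, q) (x, x) \<le> dist p x + dist q x"
            by (simp add: dist_Pair_Pair sqrt_sum_squares_le_sum)
          also have "\<dots> < d1"
            using that st unfolding d_def dist_real_def by auto
          finally show ?thesis
            using d1(2)[of "(p, q)"] that 0 by auto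
        qed
        have nearO: "dist (Obs (X p)) (Obs (X x)) < e / 2" if "p \<in> {s..t}" for p
          using that st 0 by (intro d2(2)) (auto simp: d_def dist_real_def)
        let ?I1 = "\<lambda>\<sigma>. cinner (w t) (A (X \<sigma>))"
        let ?I2 = "\<lambda>\<sigma>. h \<sigma> * cnj (Obs (X s)) - cinner (w \<sigma>) (A (X s))"
        have sub: "{s..t} \<subseteq> {0..T}"
          using 0 by auto
        have "((\<lambda>\<sigma>. cinner (w t) (X \<sigma>)) has_vector_derivative ?I1 \<sigma>) (at \<sigma> within {s..t})"
          if "\<sigma> \<in> {s..t}" for \<sigma>
          using has_vector_derivative_within_subset[OF X_deriv sub] that sub
          by (intro bounded_linear.has_vector_derivative[OF cinner.bounded_linear_right]) auto
        then have I1: "(?I1 has_integral cinner (w t) (X t) - cinner (w t) (X s)) {s..t}"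
          using st by (intro fundamental_theorem_of_calculus) auto
        have I2_int: "?I2 integrable_on {s..t}"
          using 0
          by (intro Henstock_Kurzweil_Integration.integrable_diff integrable_on_mult_left
              integrable_subinterval_real[OF h_int] integrable_continuous_real
              continuous_intros cinner.continuous_on continuous_on_subset[OF wc]) auto
        have I2: "integral {s..t} ?I2 = cinner (w t) (X s) - cinner (w s) (X s)"
          using 0 st X_dom[of s] by (intro backward_solution_increment[OF w h, symmetric]) auto
        have g_st: "g integrable_on {s..t}"
          using g_int by (rule integrable_subinterval_real) (rule sub)
        have sum: "((\<lambda>\<sigma>. ?I1 \<sigma> + ?I2 \<sigma> - g \<sigma>) has_integral D1 s t) {s..t}"
          using has_integral_diff[OF has_integral_add[OF I1 integrable_integral[OF I2_int]]
              integrable_integral[OF g_st]]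
          unfolding I2 D1_def by simp
        then have "D1 s t = integral {s..t} (\<lambda>\<sigma>. ?I1 \<sigma> + ?I2 \<sigma> - g \<sigma>)"
          by (rule integral_unique[symmetric])
        also have "cmod \<dots> \<le> integral {s..t} (\<lambda>\<sigma>. e * K \<sigma>)"
        proof (rule Henstock_Kurzweil_Integration.integral_norm_bound_integral)
          show "(\<lambda>\<sigma>. ?I1 \<sigma> + ?I2 \<sigma> - g \<sigma>) integrable_on {s..t}"
            using sum by (rule has_integral_integrable)
          show "(\<lambda>\<sigma>. e * K \<sigma>) integrable_on {s..t}"
            by (intro integrable_on_mult_right integrable_subinterval_real[OF K_int] sub)
          fix \<sigma> assume \<sigma>: "\<sigma> \<in> {s..t}"
          have s: "s \<in> {s..t}" "t \<in> {s..t}"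
            using st by auto
          have 1: "dist (?I1 \<sigma>) (cinner (w \<sigma>) (A (X s))) < e"
            by (rule dist_triangle_half_l[OF near[OF s(2) \<sigma>] near[OF \<sigma> s(1)]])
          have 2: "dist (Obs (X s)) (Obs (X \<sigma>)) < e"
            by (rule dist_triangle_half_l[OF nearO[OF s(1)] nearO[OF \<sigma>]])
          have "?I1 \<sigma> + ?I2 \<sigma> - g \<sigma>
              = (?I1 \<sigma> - cinner (w \<sigma>) (A (X s))) + h \<sigma> * cnj (Obs (X s) - Obs (X \<sigma>))"
            by (simp add: g_def algebra_simps)
          also have "cmod \<dots> \<le> e + cmod (h \<sigma>) * e"
            using 1 2
            by (intro norm_triangle_mono)
               (auto simp: dist_norm norm_mult simp del: complex_cnj_diff intro!: mult_left_mono)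
          finally show "cmod (?I1 \<sigma> + ?I2 \<sigma> - g \<sigma>) \<le> e * K \<sigma>"
            by (simp add: K_def algebra_simps)
        qed
        also have "\<dots> = e * integral {s..t} K"
          by simp
        finally show "cmod (D1 s t) \<le> e * integral {s..t} K" .
      qed
    qed
    then show ?thesis by (simp add: P_def)
  qed
  have "cmod (D1 0 T) \<le> 0"
  proof (rule field_le_epsilon)
    fix e :: real assume e: "e > 0"
    have K0: "integral {0..T} K \<ge> 0"
      by (intro Henstock_Kurzweil_Integration.integral_nonneg K_int) (simp add: K_def)
    have "cmod (D1 0 T) \<le> e / (integral {0..T} K + 1) * integral {0..T} K"
      using e K0 by (intro small) (auto intro: divide_pos_pos)
    also have "\<dots> \<le> 0 + e"
      using e K0 by (simp add: field_simps)
    finally show "cmod (D1 0 T) \<le> 0 + e" .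
  qed
  moreover have "w T = 0"
    using w by (simp add: backward_solution_def)
  ultimately have "- cinner (w 0) (X 0) = integral {0..T} g"
    by (simp add: D1_def cinner.zero_left)
  then show ?thesis
    unfolding g_def by (metis minus_equation_iff)
qed

section \<open>The observed system and its root vectors\<close>

locale observed_system =
  fixes T :: real
    and DA DO :: "'h::complex_hilbert set"
    and A :: "'h \<Rightarrow> 'h" and Obs :: "'h \<Rightarrow> complex"
    and lam :: "nat \<Rightarrow> complex" and L :: "nat \<Rightarrow> nat"
    and \<phi> \<psi> :: "nat \<Rightarrow> nat \<Rightarrow> 'h"
    and f :: "nat \<Rightarrow> nat \<Rightarrow> real \<Rightarrow> complex"
    and a :: 'h and c :: "nat \<Rightarrow> nat \<Rightarrow> complex"
    and u :: "real \<Rightarrow> 'h" and y :: "real \<Rightarrow> complex"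
  assumes T: "T > 0"
    and A: "linear_on DA A"
    and Obs: "linear_on DO Obs" "DA \<subseteq> DO"
    and inj_lam: "inj lam"
    and L_pos: "\<And>k. 1 \<le> L k"
    and \<phi>_dom: "\<And>k i. i \<in> {1..L k} \<Longrightarrow> \<phi> k i \<in> DA"
    and \<phi>_eigen: "\<And>k. A (\<phi> k 1) - lam k *\<^sub>C \<phi> k 1 = 0"
    and \<phi>_chain: "\<And>k i. i \<in> {2..L k} \<Longrightarrow> A (\<phi> k i) - lam k *\<^sub>C \<phi> k i = \<phi> k (i - 1)"
    and \<phi>_riesz: "riesz_basis (SIGMA k:UNIV. {1..L k}) (\<lambda>(k, i). \<phi> k i)"
    and \<psi>_dom: "\<And>k i. i \<in> {1..L k} \<Longrightarrow> \<psi> k i \<in> adj_dom DA A"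
    and \<psi>_eigen: "\<And>k. adj_op DA A (\<psi> k (L k)) - cnj (lam k) *\<^sub>C \<psi> k (L k) = 0"
    and \<psi>_chain: "\<And>k i. i \<in> {1..<L k} \<Longrightarrow>
                    adj_op DA A (\<psi> k i) - cnj (lam k) *\<^sub>C \<psi> k i = \<psi> k (i + 1)"
    and \<psi>_riesz: "riesz_basis (SIGMA k:UNIV. {1..L k}) (\<lambda>(k, i). \<psi> k i)"
    and biorthogonal: "\<And>k i l j. i \<in> {1..L k} \<Longrightarrow> j \<in> {1..L l} \<Longrightarrow>
                         cinner (\<phi> k i) (\<psi> l j) = (if k = l \<and> i = j then 1 else 0)"
    and control_system: "\<And>g. g \<in> L2_on {0<..<T} \<Longrightarrow> \<exists>v. backward_solution DA A Obs T g v"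
    and controllable: "\<And>k i. i \<in> {1..L k} \<Longrightarrow>
                         f k i \<in> H01 T \<and> control_op DA A Obs T 0 (f k i) = \<psi> k i"
    and expansion: "((\<lambda>(k, i). c k i *\<^sub>C \<phi> k i) has_sum a) (SIGMA k:UNIV. {1..L k})"
    and generic: "\<And>k i. i \<in> {1..L k} \<Longrightarrow> c k i \<noteq> 0"
    and u: "mild_solution DA A a u"
    and y: "is_observation Obs (2 * T) u y"
begin

lemma DA_subspace: "complex_vector.subspace DA"
  using A by (simp add: linear_on_def)

lemma A_add: "x \<in> DA \<Longrightarrow> z \<in> DA \<Longrightarrow> A (x + z) = A x + A z"
  using A by (simp add: linear_on_def)

lemma A_scaleC: "x \<in> DA \<Longrightarrow> A (b *\<^sub>C x) = b *\<^sub>C A x"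
  using A by (simp add: linear_on_def)

lemma Obs_add: "x \<in> DA \<Longrightarrow> z \<in> DA \<Longrightarrow> Obs (x + z) = Obs x + Obs z"
  using Obs by (simp add: linear_on_def subset_iff)

lemma Obs_scaleC: "x \<in> DA \<Longrightarrow> Obs (b *\<^sub>C x) = b * Obs x"
  using Obs by (simp add: linear_on_def subset_iff scaleC_complex_def)

lemma A_diff: "x \<in> DA \<Longrightarrow> z \<in> DA \<Longrightarrow> A (x - z) = A x - A z"
  using A_add[of "x - z" z] by (simp add: complex_vector.subspace_diff[OF DA_subspace])

lemma Obs_diff: "x \<in> DA \<Longrightarrow> z \<in> DA \<Longrightarrow> Obs (x - z) = Obs x - Obs z"
  using Obs_add[of "x - z" z] by (simp add: complex_vector.subspace_diff[OF DA_subspace])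

lemma A_sum:
  assumes "finite I" "\<And>i. i \<in> I \<Longrightarrow> x i \<in> DA"
  shows "A (\<Sum>i\<in>I. b i *\<^sub>C x i) = (\<Sum>i\<in>I. b i *\<^sub>C A (x i))"
    and "Obs (\<Sum>i\<in>I. b i *\<^sub>C x i) = (\<Sum>i\<in>I. b i * Obs (x i))"
proof -
  have "0 \<in> DA"
    using DA_subspace by (rule complex_vector.subspace_0)
  then have 0: "A 0 = 0" "Obs 0 = 0"
    using A_scaleC[of 0 0] Obs_scaleC[of 0 0] by simp_all
  have mem: "(\<Sum>i\<in>J. b i *\<^sub>C x i) \<in> DA" if "J \<subseteq> I" for J
    using that assms(2)
    by (intro complex_vector.subspace_sum complex_vector.subspace_scale DA_subspace) auto
  have "J \<subseteq> I \<Longrightarrow> A (\<Sum>i\<in>J. b i *\<^sub>C x i) = (\<Sum>i\<in>J. b i *\<^sub>C A (x i)) \<and>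
        Obs (\<Sum>i\<in>J. b i *\<^sub>C x i) = (\<Sum>i\<in>J. b i * Obs (x i))" if "finite J" for J
    using that
  proof (induction J)
    case (insert j J)
    then have "x j \<in> DA" "b j *\<^sub>C x j \<in> DA"
      using assms(2)[of j] DA_subspace by (auto intro: complex_vector.subspace_scale)
    then show ?case
      using insert mem[of J] by (simp add: A_add Obs_add A_scaleC Obs_scaleC)
  qed (simp add: 0)
  then show "A (\<Sum>i\<in>I. b i *\<^sub>C x i) = (\<Sum>i\<in>I. b i *\<^sub>C A (x i))"
    "Obs (\<Sum>i\<in>I. b i *\<^sub>C x i) = (\<Sum>i\<in>I. b i * Obs (x i))"
    using assms(1) by blast+
qed

lemma A_\<phi>:
  assumes "i \<in> {1..L k}"
  shows "A (\<phi> k i) = lam k *\<^sub>C \<phi> k i + (if i = 1 then 0 else \<phi> k (i - 1))"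
  using assms \<phi>_eigen[of k] \<phi>_chain[of i k] by (auto simp: algebra_simps)

lemma \<phi>_total: "(\<And>k i. i \<in> {1..L k} \<Longrightarrow> cinner (\<phi> k i) x = 0) \<Longrightarrow> x = 0"
  using \<phi>_riesz unfolding riesz_basis_def by (auto elim!: eq_0_if_orthogonal_to_total)

lemma \<psi>_total: "(\<And>k i. i \<in> {1..L k} \<Longrightarrow> cinner x (\<psi> k i) = 0) \<Longrightarrow> x = 0"
  using \<psi>_riesz cinner_commute[of x] unfolding riesz_basis_def
  by (auto elim!: eq_0_if_orthogonal_to_total)

text \<open>The chain relations of \<open>\<psi>\<close> are usable only through pairings with the domain. The adjoint is
  well defined there because the domain contains the total family \<open>\<phi>\<close>.\<close>

lemma adjoint_\<psi>:
  assumes i: "i \<in> {1..L k}" and x: "x \<in> DA"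
  shows "cinner (A x) (\<psi> k i)
       = lam k * cinner x (\<psi> k i) + (if i = L k then 0 else cinner x (\<psi> k (i + 1)))"
proof -
  obtain z where z: "\<forall>x\<in>DA. cinner (A x) (\<psi> k i) = cinner x z"
    using \<psi>_dom[OF i] by (auto simp: adj_dom_def)
  have "adj_op DA A (\<psi> k i) = z"
    unfolding adj_op_def
  proof (rule the_equality)
    show "\<forall>x\<in>DA. cinner (A x) (\<psi> k i) = cinner x z"
      by (rule z)
    fix z' assume z': "\<forall>x\<in>DA. cinner (A x) (\<psi> k i) = cinner x z'"
    have "z' - z = 0"
      using z z' \<phi>_dom by (intro \<phi>_total) (simp add: cinner.diff_right)
    then show "z' = z"
      by simp
  qed
  then have "z = cnj (lam k) *\<^sub>C \<psi> k i + (if i = L k then 0 else \<psi> k (i + 1))"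
    using i \<psi>_eigen[of k] \<psi>_chain[of i k] by (auto simp: algebra_simps)
  then show ?thesis
    using z x by (simp add: cinner_add_right cinner_scaleC_right cinner.zero_right)
qed

text \<open>The functions \<open>s\<^sup>m exp(\<lambda> s) / m!\<close>, through which the flow acts on a chain of root
  vectors.\<close>

definition chain_fun :: "nat \<Rightarrow> nat \<Rightarrow> real \<Rightarrow> complex" where
  "chain_fun k m s = exp (lam k * of_real s) * of_real s ^ m / fact m"

lemma chain_fun_0: "chain_fun k m 0 = (if m = 0 then 1 else 0)"
  by (simp add: chain_fun_def)

lemma chain_fun_deriv:
  "(chain_fun k m has_vector_derivative
     lam k * chain_fun k m s + (if m = 0 then 0 else chain_fun k (m - 1) s)) (at s within S)"
proof -
  have "((\<lambda>z. exp (lam k * z) * z ^ m / fact m) has_field_derivative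
     lam k * (exp (lam k * z) * z ^ m / fact m) +
     (if m = 0 then 0 else exp (lam k * z) * z ^ (m - 1) / fact (m - 1))) (at z)" for z
  proof (cases m)
    case (Suc q)
    have "((\<lambda>z. z ^ Suc q / fact (Suc q)) has_field_derivative
        (1 + of_nat q) * (1 * z ^ q) / fact (Suc q)) (at z)"
      by (intro DERIV_cdivide DERIV_power_Suc DERIV_ident)
    also have "(1 + of_nat q) * (1 * z ^ q) / fact (Suc q) = z ^ q / (fact q :: complex)"
    proof -
      have "fact (Suc q) = (1 + of_nat q) * (fact q :: complex)"
        by (simp add: fact_Suc algebra_simps)
      moreover have "1 + of_nat q \<noteq> (0 :: complex)"
        using of_nat_neq_0[of q] by (simp only: of_nat_Suc)
      ultimately show ?thesis
        by (metis mult_1 mult_divide_mult_cancel_left)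
    qed
    finally have power: "((\<lambda>z. z ^ Suc q / fact (Suc q)) has_field_derivative z ^ q / fact q) (at z)" .
    have "((\<lambda>z. exp (lam k * z)) has_field_derivative lam k * exp (lam k * z)) (at z)"
      by (auto intro!: derivative_eq_intros)
    from DERIV_mult[OF this power] show ?thesis
      by (simp add: Suc algebra_simps del: fact_Suc power_Suc)
  qed (auto intro!: derivative_eq_intros)
  from has_vector_derivative_real_field[OF this, of s]
  show ?thesis
    unfolding chain_fun_def[abs_def] by (auto intro: has_vector_derivative_at_within simp: o_def)
qed

lemma chain_fun_continuous: "continuous_on S (chain_fun k m)"
  by (auto simp: continuous_on_eq_continuous_within
      intro!: has_vector_derivative_continuous chain_fun_deriv)

text \<open>The solution of \<open>X' = A X\<close>, \<open>X(0) = \<phi> k j\<close>.\<close>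

definition root_solution :: "nat \<Rightarrow> nat \<Rightarrow> real \<Rightarrow> 'h" where
  "root_solution k j s = (\<Sum>m<j. chain_fun k m s *\<^sub>C \<phi> k (j - m))"

definition root_observation :: "nat \<Rightarrow> nat \<Rightarrow> real \<Rightarrow> complex" where
  "root_observation k j s = (\<Sum>m<j. chain_fun k m s * Obs (\<phi> k (j - m)))"

lemma root_observation_continuous: "continuous_on S (root_observation k j)"
  unfolding root_observation_def
  by (intro continuous_intros continuous_on_compose2[OF chain_fun_continuous]) auto

lemma root_solution:
  assumes j: "j \<in> {1..L k}"
  shows "root_solution k j s \<in> DA"
    and "(root_solution k j has_vector_derivative A (root_solution k j s)) (at s within S)"
    and "Obs (root_solution k j s) = root_observation k j s"
    and "continuous_on S (\<lambda>s. A (root_solution k j s))"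
    and "root_solution k j 0 = \<phi> k j"
proof -
  have dom: "\<phi> k (j - m) \<in> DA" if "m < j" for m
    using that j by (intro \<phi>_dom) auto
  then show "root_solution k j s \<in> DA"
    unfolding root_solution_def
    by (intro complex_vector.subspace_sum complex_vector.subspace_scale DA_subspace) auto
  show "Obs (root_solution k j s) = root_observation k j s"
    unfolding root_solution_def root_observation_def using dom by (subst A_sum) auto
  have AX: "A (root_solution k j s) = (\<Sum>m<j. chain_fun k m s *\<^sub>C A (\<phi> k (j - m)))" for s
    unfolding root_solution_def using dom by (subst A_sum) auto
  show "continuous_on S (\<lambda>s. A (root_solution k j s))"
    unfolding AX
    by (intro continuous_intros scaleC.continuous_on
        continuous_on_compose2[OF chain_fun_continuous]) auto
  have "j = Suc (j - 1)"
    using j by simp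
  then have "root_solution k j 0 = (\<Sum>m<Suc (j - 1). chain_fun k m 0 *\<^sub>C \<phi> k (j - m))"
    by (simp add: root_solution_def)
  also have "\<dots> = \<phi> k j"
    by (subst sum.lessThan_Suc_shift) (simp add: chain_fun_0 scaleC.zero_left)
  finally show "root_solution k j 0 = \<phi> k j" .
  define d where "d m = (if m = 0 then 0 else chain_fun k (m - 1) s)" for m
  have "((\<lambda>s. \<Sum>m<j. chain_fun k m s *\<^sub>C \<phi> k (j - m)) has_vector_derivative
      (\<Sum>m<j. (lam k * chain_fun k m s + d m) *\<^sub>C \<phi> k (j - m))) (at s within S)"
    unfolding d_def
    by (intro has_vector_derivative_sum
        bounded_linear.has_vector_derivative[OF scaleC.bounded_linear_left] chain_fun_deriv)
  moreover have "(\<Sum>m<j. (lam k * chain_fun k m s + d m) *\<^sub>C \<phi> k (j - m))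
      = (\<Sum>m<j. chain_fun k m s *\<^sub>C A (\<phi> k (j - m)))"
  proof -
    obtain q where q: "j = Suc q"
      using j by (cases j) auto
    have "(\<Sum>m<j. d m *\<^sub>C \<phi> k (j - m)) = (\<Sum>m<q. chain_fun k m s *\<^sub>C \<phi> k (q - m))"
      unfolding q by (subst sum.lessThan_Suc_shift) (simp add: d_def scaleC.zero_left)
    also have "\<dots> = (\<Sum>m<j. chain_fun k m s *\<^sub>C (if j - m = 1 then 0 else \<phi> k (j - m - 1)))"
      unfolding q by (auto simp: scaleC.zero_right intro!: sum.cong)
    finally have shift: "(\<Sum>m<j. d m *\<^sub>C \<phi> k (j - m))
        = (\<Sum>m<j. chain_fun k m s *\<^sub>C (if j - m = 1 then 0 else \<phi> k (j - m - 1)))" .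
    have "(\<Sum>m<j. chain_fun k m s *\<^sub>C A (\<phi> k (j - m)))
        = (\<Sum>m<j. (lam k * chain_fun k m s) *\<^sub>C \<phi> k (j - m) +
            chain_fun k m s *\<^sub>C (if j - m = 1 then 0 else \<phi> k (j - m - 1)))"
      using j by (intro sum.cong refl, subst A_\<phi>) (auto simp: scaleC_add_right scaleC_scaleC mult.commute)
    then show ?thesis
      by (simp add: sum.distrib shift scaleC_add_left)
  qed
  ultimately show "(root_solution k j has_vector_derivative A (root_solution k j s)) (at s within S)"
    unfolding AX by (simp add: root_solution_def[abs_def])
qed

section \<open>The control operator in root coordinates\<close>

abbreviation W :: "(real \<Rightarrow> complex) \<Rightarrow> 'h" where
  "W h \<equiv> control_op DA A Obs T 0 h"

lemma sq_integrable_imp_L2_on: "sq_integrable h \<Longrightarrow> h \<in> L2_on {0<..<T}"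
  unfolding L2_on_def sq_integrable_def set_borel_measurable_def set_integrable_def
  by (auto intro!: integrable_mult_indicator simp del: real_scaleR_def)

text \<open>Duality along the solution that starts from a root vector: the coordinates of the controlled
  state are the products of the control with observations that are known explicitly.\<close>

lemma backward_solution_coordinates:
  assumes w: "backward_solution DA A Obs T h w" and h: "sq_integrable h" and j: "j \<in> {1..L k}"
  shows "cinner (w 0) (\<phi> k j) = - integral {0..T} (\<lambda>s. h s * cnj (root_observation k j s))"
  using duality[OF w h, of "root_solution k j"] T root_solution[OF j] root_observation_continuous
  by (simp add: order.strict_implies_order)

text \<open>The values \<open>w(0)\<close> are determined by the control, since their products with the total family
  of root vectors are.\<close>

lemma W_eq:
  assumes w: "backward_solution DA A Obs T h w" and h: "sq_integrable h"
  shows "W h = w 0"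
  unfolding control_op_def
proof (rule the_equality)
  show "\<exists>v. backward_solution DA A Obs T h v \<and> v 0 = w 0"
    using w by blast
  fix x assume "\<exists>v. backward_solution DA A Obs T h v \<and> v 0 = x"
  then obtain v where v: "backward_solution DA A Obs T h v" "v 0 = x"
    by blast
  have "cinner (v 0) (\<phi> k i) = cinner (w 0) (\<phi> k i)" if "i \<in> {1..L k}" for k i
    using backward_solution_coordinates[OF v(1) h that] backward_solution_coordinates[OF w h that]
    by simp
  then have "v 0 - w 0 = 0"
    by (intro \<phi>_total) (metis cinner.diff_right cinner_commute eq_iff_diff_eq_0)
  then show "x = w 0"
    using v by simp
qed

lemma backward_solution_exists:
  assumes "sq_integrable h"
  obtains w where "backward_solution DA A Obs T h w" "W h = w 0"
  using control_system[OF sq_integrable_imp_L2_on[OF assms]] W_eq assms by blast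

text \<open>Up to conjugation, the coefficients of \<open>W h\<close> in the basis \<open>\<psi>\<close>. The root vector \<open>\<phi> k j\<close>
  stands in the first slot so that \<open>A\<close> can act on it.\<close>

definition coord :: "(real \<Rightarrow> complex) \<Rightarrow> nat \<Rightarrow> nat \<Rightarrow> complex" where
  "coord h k j = cinner (\<phi> k j) (W h)"

lemma coord_eq:
  assumes h: "sq_integrable h" and j: "j \<in> {1..L k}"
  shows "coord h k j = - integral {0..T} (\<lambda>s. cnj (h s) * root_observation k j s)"
proof -
  obtain w where w: "backward_solution DA A Obs T h w" "W h = w 0"
    using backward_solution_exists[OF h] .
  have "coord h k j = cnj (cinner (w 0) (\<phi> k j))"
    by (metis coord_def w(2) cinner_commute)
  also have "\<dots> = - integral {0..T} (\<lambda>s. cnj (h s) * root_observation k j s)"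
    unfolding backward_solution_coordinates[OF w(1) h j] by (simp add: integral_cnj)
  finally show ?thesis .
qed

lemma coord_add_scale:
  assumes g: "sq_integrable g" and h: "sq_integrable h" and gh: "sq_integrable (\<lambda>s. g s + b * h s)"
    and j: "j \<in> {1..L k}"
  shows "coord (\<lambda>s. g s + b * h s) k j = coord g k j + cnj b * coord h k j"
proof -
  have int: "(\<lambda>s. cnj (q s) * root_observation k j s) integrable_on {0..T}" if "sq_integrable q" for q
    by (intro set_borel_integral_eq_integral set_integrable_mult_continuous sq_integrable_cnj that
        root_observation_continuous)
  have "integral {0..T} (\<lambda>s. cnj (g s + b * h s) * root_observation k j s)
      = integral {0..T} (\<lambda>s. cnj (g s) * root_observation k j s
          + cnj b * (cnj (h s) * root_observation k j s))"
    by (simp add: algebra_simps)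
  also have "\<dots> = integral {0..T} (\<lambda>s. cnj (g s) * root_observation k j s)
      + cnj b * integral {0..T} (\<lambda>s. cnj (h s) * root_observation k j s)"
    by (subst Henstock_Kurzweil_Integration.integral_add)
       (auto intro!: int g h integrable_on_mult_right)
  finally show ?thesis
    unfolding coord_eq[OF gh j] coord_eq[OF g j] coord_eq[OF h j] by simp
qed


section \<open>The observation and its correlation with controls\<close>

text \<open>Extended by zero to the line, the observation can be shifted by any amount.\<close>

definition obs :: "real \<Rightarrow> complex" where
  "obs t = indicator {0<..<2*T} t *\<^sub>R y t"

definition u_integral :: "real \<Rightarrow> 'h" where
  "u_integral t = integral {0..t} u"

lemma sq_integrable_obs: "sq_integrable obs"
proof -
  have "y \<in> L2_on {0<..<2*T}"
    using y by (simp add: is_observation_def)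
  then have "obs \<in> borel_measurable borel"
    and int: "integrable lborel (\<lambda>t. indicator {0<..<2*T} t *\<^sub>R (cmod (y t))\<^sup>2)"
    unfolding L2_on_def set_borel_measurable_def set_integrable_def obs_def[abs_def] by simp_all
  moreover have "indicator {0<..<2*T} t *\<^sub>R (cmod (y t))\<^sup>2 = (cmod (obs t))\<^sup>2" for t
    by (cases "t \<in> {0<..<2*T}") (auto simp: obs_def)
  ultimately show ?thesis
    unfolding sq_integrable_def by (auto simp only:)
qed

lemma u_continuous: "continuous_on {0..S} u"
proof -
  have "continuous_on {0..} u"
    using u unfolding mild_solution_def by blast
  then show ?thesis
    by (rule continuous_on_subset) auto
qed

lemma u_integral_deriv:
  "t \<in> {0..S} \<Longrightarrow> (u_integral has_vector_derivative u t) (at t within {0..S})"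
  unfolding u_integral_def[abs_def] by (rule integral_has_vector_derivative[OF u_continuous])

lemma u_integral:
  assumes "0 \<le> t"
  shows "u_integral t \<in> DA" and "A (u_integral t) = u t - a"
proof -
  have "u_integral t \<in> DA \<and> u t = a + A (u_integral t)"
    using u assms unfolding mild_solution_def u_integral_def by blast
  then show "u_integral t \<in> DA" and "A (u_integral t) = u t - a"
    by simp_all
qed

lemma Obs_u_integral:
  assumes "t \<in> {0..2*T}"
  shows "Obs (u_integral t) = integral {0..t} obs"
proof -
  have "Obs (u_integral t) = (LINT s:{0<..<t}|lborel. y s)"
    using y assms by (simp add: is_observation_def u_integral_def)
  also have "\<dots> = (LINT s:{0<..<t}|lborel. obs s)"
    using assms by (intro set_lebesgue_integral_cong) (auto simp: obs_def)
  also have "\<dots> = integral {0..t} obs"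
    by (intro LINT_open_interval_eq_integral sq_integrable_imp_set_integrable sq_integrable_obs)
  finally show ?thesis .
qed

lemma integral_obs_shift:
  assumes "0 \<le> r" "0 \<le> s"
  shows "integral {0..s + r} obs - integral {0..s} obs = (LINT \<rho>:{0..r}|lborel. obs (s + \<rho>))"
proof -
  have si: "set_integrable lborel {b..d} obs" for b d
    by (intro sq_integrable_imp_set_integrable sq_integrable_obs)
  have "integral {0..s} obs + integral {s..s + r} obs = integral {0..s + r} obs"
    using assms
    by (intro Henstock_Kurzweil_Integration.integral_combine set_borel_integral_eq_integral si) auto
  then have "integral {0..s + r} obs - integral {0..s} obs = integral {s..s + r} obs"
    by (simp add: algebra_simps)
  also have "\<dots> = (LINT t:{s..s + r}|lborel. obs t)"
    by (intro set_borel_integral_eq_integral(2)[symmetric] si)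
  also have "\<dots> = (\<integral>\<rho>. indicator {s..s + r} (s + 1 * \<rho>) *\<^sub>R obs (s + 1 * \<rho>) \<partial>lborel)"
    unfolding set_lebesgue_integral_def
    using lborel_integral_real_affine[of 1 "\<lambda>t. indicator {s..s + r} t *\<^sub>R obs t" s] by simp
  also have "\<dots> = (LINT \<rho>:{0..r}|lborel. obs (s + \<rho>))"
    unfolding set_lebesgue_integral_def
    by (intro Bochner_Integration.integral_cong) (auto simp: indicator_def)
  finally show ?thesis .
qed

text \<open>The duality lemma needs a trajectory in the domain, which \<open>u\<close> need not be. Its integral over
  a moving window, \<open>X(s) = \<integral>\<^bsub>s\<^esub>\<^bsup>s + r\<^esup> u\<close>, is one: it solves the same equation classically, and its
  observation is the integral of \<open>y\<close> over the window.\<close>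

lemma integral_correlation_obs:
  assumes h: "sq_integrable h" and h0: "\<And>s. s \<notin> {0<..<T} \<Longrightarrow> h s = 0" and r: "r \<in> {0..T}"
  shows "integral {0..r} (correlation obs (\<lambda>s. cnj (h s))) = - cinner (u_integral r) (W h)"
proof -
  obtain w where w: "backward_solution DA A Obs T h w" and W: "W h = w 0"
    using backward_solution_exists[OF h] .
  define X where "X s = u_integral (s + r) - u_integral s" for s
  have A_X: "A (X s) = u (s + r) - u s" and dom: "X s \<in> DA" if "s \<in> {0..T}" for s
    using that r DA_subspace
    by (auto simp: X_def A_diff u_integral intro: complex_vector.subspace_diff)
  have Obs_X: "Obs (X s) = (LINT \<rho>:{0..r}|lborel. obs (s + \<rho>))" if "s \<in> {0..T}" for s
    using that r integral_obs_shift[of r s] by (simp add: X_def Obs_diff u_integral Obs_u_integral)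
  have deriv: "(X has_vector_derivative A (X s)) (at s within {0..T})" if s: "s \<in> {0..T}" for s
  proof -
    have "((u_integral \<circ> (\<lambda>s. s + r)) has_vector_derivative 1 *\<^sub>R u (s + r)) (at s within {0..T})"
    proof (rule vector_diff_chain_within)
      show "((\<lambda>s. s + r) has_vector_derivative 1) (at s within {0..T})"
        by (auto intro!: derivative_eq_intros)
      show "(u_integral has_vector_derivative u (s + r)) (at (s + r) within (\<lambda>s. s + r) ` {0..T})"
        by (rule has_vector_derivative_within_subset[OF u_integral_deriv[of _ "2*T"]])
           (use s r in auto)
    qed
    then show ?thesis
      unfolding X_def[abs_def] A_X[OF s, unfolded X_def]
      by (auto simp: o_def intro!: has_vector_derivative_diff u_integral_deriv s)
  qed
  have cont_A: "continuous_on {0..T} (\<lambda>s. A (X s))"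
  proof -
    have "continuous_on {0..T} (\<lambda>s. u (s + r) - u s)"
      using r by (intro continuous_intros continuous_on_compose2[OF u_continuous[of "2*T"]] u_continuous) auto
    then show ?thesis
      by (subst continuous_on_cong[OF refl A_X]) auto
  qed
  have cont_I: "continuous_on {0..2*T} (\<lambda>t. integral {0..t} obs)"
    by (intro indefinite_integral_continuous_1 set_borel_integral_eq_integral
        sq_integrable_imp_set_integrable sq_integrable_obs)
  have cont_Obs: "continuous_on {0..T} (\<lambda>s. Obs (X s))"
  proof -
    have "continuous_on {0..T} (\<lambda>s. integral {0..s + r} obs - integral {0..s} obs)"
      using r by (intro continuous_intros continuous_on_compose2[OF cont_I]) auto
    then show ?thesis
      using r by (subst continuous_on_cong[OF refl, of _ _ "\<lambda>s. integral {0..s + r} obs - integral {0..s} obs"])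
        (auto simp: Obs_X integral_obs_shift)
  qed
  have "X 0 = u_integral r"
    by (simp add: X_def u_integral_def)
  then have "cinner (w 0) (u_integral r) = - integral {0..T} (\<lambda>s. h s * cnj (Obs (X s)))"
    using duality[OF w h _ dom deriv cont_A cont_Obs] T by simp
  then have "cinner (u_integral r) (w 0) = - integral {0..T} (\<lambda>s. Obs (X s) * cnj (h s))"
    by (subst cinner_commute) (simp add: integral_cnj mult.commute)
  also have "integral {0..T} (\<lambda>s. Obs (X s) * cnj (h s))
      = (LINT s:{0..T}|lborel. Obs (X s) * cnj (h s))"
    using set_integrable_mult_continuous[OF sq_integrable_cnj[OF h] cont_Obs]
    by (simp add: mult.commute set_borel_integral_eq_integral)
  also have "\<dots> = (\<integral>s. (LINT \<rho>:{0..r}|lborel. obs (s + \<rho>)) * cnj (h s) \<partial>lborel)"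
    unfolding set_lebesgue_integral_def[of lborel "{0..T}"]
  proof (intro Bochner_Integration.integral_cong refl)
    fix s
    show "indicator {0..T} s *\<^sub>R (Obs (X s) * cnj (h s))
        = (LINT \<rho>:{0..r}|lborel. obs (s + \<rho>)) * cnj (h s)"
      using Obs_X[of s] h0[of s] by (cases "s \<in> {0..T}") auto
  qed
  also have "\<dots> = (LINT \<rho>:{0..r}|lborel. correlation obs (\<lambda>s. cnj (h s)) \<rho>)"
    by (rule integral_correlation[symmetric, OF sq_integrable_obs sq_integrable_cnj[OF h]])
  also have "\<dots> = integral {0..r} (correlation obs (\<lambda>s. cnj (h s)))"
    by (intro set_borel_integral_eq_integral borel_integrable_atLeastAtMost'
        continuous_on_subset[OF correlation_continuous[OF sq_integrable_obs sq_integrable_cnj[OF h]]]) auto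
  finally show ?thesis
    by (simp add: W)
qed

text \<open>The observation of a mild solution exists only in the \<open>L\<^sub>2\<close> sense, so duality is first
  used for its time integral. The resulting identity may be differentiated in the shift, as
  correlations are continuous.\<close>

theorem correlation_obs:
  assumes h: "sq_integrable h" and h0: "\<And>s. s \<notin> {0<..<T} \<Longrightarrow> h s = 0" and r: "r \<in> {0..T}"
  shows "correlation obs (\<lambda>s. cnj (h s)) r = - cinner (u r) (W h)"
proof (rule vector_derivative_unique_within_closed_interval[OF T, unfolded cbox_interval, OF r])
  let ?\<Phi> = "correlation obs (\<lambda>s. cnj (h s))"
  have "continuous_on {0..T} ?\<Phi>"
    by (intro continuous_on_subset[OF correlation_continuous] sq_integrable_obs sq_integrable_cnj h) auto
  then show "((\<lambda>r. integral {0..r} ?\<Phi>) has_vector_derivative ?\<Phi> r) (at r within {0..T})"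
    using r by (rule integral_has_vector_derivative)
  have "((\<lambda>r. - cinner (u_integral r) (W h)) has_vector_derivative - cinner (u r) (W h)) (at r within {0..T})"
    by (intro has_vector_derivative_minus u_integral_deriv r
        bounded_linear.has_vector_derivative[OF cinner.bounded_linear_left])
  then show "((\<lambda>r. integral {0..r} ?\<Phi>) has_vector_derivative - cinner (u r) (W h)) (at r within {0..T})"
    using r by (rule has_vector_derivative_transform[rotated 2])
      (use integral_correlation_obs[OF h h0] in auto)
qed

lemma LINT_obs:
  "(LINT t:{0<..<2*T}|lborel. cinner (y t) (h (t - T + \<tau>)))
   = correlation obs (\<lambda>s. cnj (h s)) (T - \<tau>)"
proof -
  have "(LINT t:{0<..<2*T}|lborel. cinner (y t) (h (t - T + \<tau>)))
      = (\<integral>t. obs t * cnj (h (t - T + \<tau>)) \<partial>lborel)"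
    by (simp add: set_lebesgue_integral_def obs_def cinner_complex_def)
  also have "\<dots> = correlation obs (\<lambda>s. cnj (h s)) (T - \<tau>)"
    unfolding correlation_def
    using lborel_integral_real_affine[of 1 "\<lambda>t. obs t * cnj (h (t - T + \<tau>))" "T - \<tau>"]
    by (simp add: add.commute)
  finally show ?thesis .
qed

section \<open>Controls in the Sobolev space\<close>

lemma is_wderiv_wderiv:
  assumes "F \<in> H01 T"
  shows "is_wderiv T F (wderiv T F)"
proof -
  have "\<exists>g. is_wderiv T F g"
    using assms by (simp add: H01_def)
  then show ?thesis
    unfolding wderiv_def by (rule someI_ex)
qed

lemma is_wderiv_sq_integrable:
  assumes "is_wderiv T F g"
  shows "sq_integrable g"
proof -
  have g: "g \<in> L2_on {0<..<T}" and g0: "\<And>t. t \<notin> {0<..<T} \<Longrightarrow> g t = 0"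
    using assms by (auto simp: is_wderiv_def)
  have "(\<lambda>t. indicator {0<..<T} t *\<^sub>R g t) = g"
    "(\<lambda>t. indicator {0<..<T} t *\<^sub>R (cmod (g t))\<^sup>2) = (\<lambda>t. (cmod (g t))\<^sup>2)"
    using g0 by (fastforce simp: indicator_def)+
  then show ?thesis
    using g unfolding L2_on_def sq_integrable_def set_borel_measurable_def set_integrable_def by simp
qed

lemma is_wderiv_integral:
  assumes F: "is_wderiv T F g" and t: "t \<in> {0..T}"
  shows "F t = integral {0..t} g"
  using F t LINT_open_interval_eq_integral[OF sq_integrable_imp_set_integrable,
      OF is_wderiv_sq_integrable[OF F]]
  by (simp add: is_wderiv_def)

lemma H01_zero_outside: "F \<in> H01 T \<Longrightarrow> t \<notin> {0<..<T} \<Longrightarrow> F t = 0"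
  by (auto simp: H01_def is_wderiv_def)

lemma wderiv_zero_outside: "F \<in> H01 T \<Longrightarrow> t \<notin> {0<..<T} \<Longrightarrow> wderiv T F t = 0"
  using is_wderiv_wderiv[of F] by (simp add: is_wderiv_def)

lemma sq_integrable_wderiv: "F \<in> H01 T \<Longrightarrow> sq_integrable (wderiv T F)"
  by (rule is_wderiv_sq_integrable[OF is_wderiv_wderiv])

lemma H01_continuous:
  assumes "F \<in> H01 T"
  shows "continuous_on {0..T} F"
proof -
  have "continuous_on {0..T} (\<lambda>t. integral {0..t} (wderiv T F))"
    by (intro indefinite_integral_continuous_1 set_borel_integral_eq_integral
        sq_integrable_imp_set_integrable sq_integrable_wderiv assms)
  then show ?thesis
    using is_wderiv_integral[OF is_wderiv_wderiv[OF assms]]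
    by (subst continuous_on_cong[OF refl]) auto
qed

lemma H01_sq_integrable:
  assumes F: "F \<in> H01 T"
  shows "sq_integrable F"
proof -
  have "(\<lambda>t. indicator {0..T} t *\<^sub>R F t) = F"
    using H01_zero_outside[OF F] by (fastforce simp: indicator_def)
  then have "F \<in> borel_measurable borel"
    using borel_measurable_continuous_on_indicator[OF _ H01_continuous[OF F]] by simp
  moreover obtain B where "\<And>t. t \<in> {0..T} \<Longrightarrow> cmod (F t) \<le> B"
    using compact_imp_bounded[OF compact_continuous_image[OF H01_continuous[OF F] compact_Icc]]
    unfolding bounded_iff by fastforce
  ultimately show ?thesis
    using H01_zero_outside[OF F]
    by (intro sq_integrable_bounded_support[of F "max 0 B" 0 T])
       (auto simp: le_max_iff_disj, metis greaterThanLessThan_iff less_eq_real_def norm_zero)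
qed

lemma sq_integrable_add_scale:
  assumes "sq_integrable g" "sq_integrable h"
  shows "sq_integrable (\<lambda>s. g s + b * h s)"
proof -
  have "sq_integrable (\<lambda>s. - b * h s)"
    using assms(2) by (auto simp: sq_integrable_def norm_mult power_mult_distrib)
  from sq_integrable_diff[OF assms(1) this] show ?thesis
    by simp
qed

lemma H01_add_scale:
  assumes F: "F \<in> H01 T" and G: "G \<in> H01 T"
  shows "(\<lambda>t. F t + b * G t) \<in> H01 T"
proof -
  let ?f = "wderiv T F" and ?g = "wderiv T G"
  have f: "is_wderiv T F ?f" and g: "is_wderiv T G ?g"
    using F G is_wderiv_wderiv by auto
  have sf: "sq_integrable ?f" and sg: "sq_integrable ?g"
    using F G sq_integrable_wderiv by auto
  have int: "set_integrable lborel {0<..<t} ?f" "set_integrable lborel {0<..<t} (\<lambda>s. b * ?g s)" for t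
    by (rule set_integrable_subset[OF sq_integrable_imp_set_integrable[OF sf], of _ 0 t];
        auto)
      (intro set_integrable_mult_right
        set_integrable_subset[OF sq_integrable_imp_set_integrable[OF sg], of _ 0 t]; auto)
  have "is_wderiv T (\<lambda>t. F t + b * G t) (\<lambda>t. ?f t + b * ?g t)"
    unfolding is_wderiv_def
  proof (intro conjI ballI allI impI)
    show "(\<lambda>t. ?f t + b * ?g t) \<in> L2_on {0<..<T}"
      by (intro sq_integrable_imp_L2_on sq_integrable_add_scale sf sg)
    fix t assume "t \<in> {0..T}"
    then show "F t + b * G t = (LINT s:{0<..<t}|lborel. ?f s + b * ?g s)"
      using f g int[of t] by (subst set_integral_add) (auto simp: is_wderiv_def)
  qed (simp_all add: H01_zero_outside[OF F] H01_zero_outside[OF G] wderiv_zero_outside[OF F]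
      wderiv_zero_outside[OF G])
  then show ?thesis
    by (auto simp: H01_def)
qed

lemma H01_zero: "(\<lambda>_. 0) \<in> H01 T"
  unfolding H01_def is_wderiv_def
  by (auto intro!: exI[of _ "\<lambda>_. 0"] sq_integrable_imp_L2_on simp: sq_integrable_def)

text \<open>The time derivative of the controlled solution is the solution for the differentiated
  control; at the initial time the control vanishes, so the equation reads
  \<open>W f' = v'(0) = - A\<^sup>* v(0) = - A\<^sup>* W f\<close>.\<close>

lemma W_wderiv:
  assumes F: "F \<in> H01 T" and x: "x \<in> DA"
  shows "cinner (W (wderiv T F)) x = - cinner (W F) (A x)"
proof -
  define g where "g = wderiv T F"
  have g: "sq_integrable g"
    using F by (simp add: g_def sq_integrable_wderiv)
  have FI: "F t = integral {0..t} g" if "t \<in> {0..T}" for t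
    unfolding g_def by (rule is_wderiv_integral[OF is_wderiv_wderiv[OF F] that])
  have g_int: "g integrable_on {b..d}" for b d
    by (intro set_borel_integral_eq_integral sq_integrable_imp_set_integrable g)
  obtain w where w: "backward_solution DA A Obs T g w" and W: "W g = w 0"
    using backward_solution_exists[OF g] .
  have wc: "continuous_on {0..T} w" and wT: "w T = 0"
    using w by (auto simp: backward_solution_def)
  have w_int: "w integrable_on {s..T}" if "0 \<le> s" for s
    using that by (intro integrable_continuous_real continuous_on_subset[OF wc]) auto
  \<comment> \<open>The candidate for the solution with control \<open>F\<close>: it has derivative \<open>w\<close> and vanishes at \<open>T\<close>.\<close>
  define v where "v s = - integral {s..T} w" for s
  have step: "cinner (v s) (A x) - F s * cnj (Obs x) = - cinner (w s) x"
    if s: "s \<in> {0..T}" and x: "x \<in> DA" for s x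
  proof -
    have wA: "(\<lambda>\<sigma>. cinner (w \<sigma>) (A x)) integrable_on {s..T}"
      using s by (intro integrable_continuous_real cinner.continuous_on continuous_intros
          continuous_on_subset[OF wc]) auto
    have gO: "(\<lambda>\<sigma>. g \<sigma> * cnj (Obs x)) integrable_on {s..T}"
      by (intro integrable_on_mult_left g_int)
    have "integral {0..s} g + integral {s..T} g = integral {0..T} g"
      using s by (intro Henstock_Kurzweil_Integration.integral_combine g_int) auto
    then have "integral {s..T} g = - F s"
      using FI[of s] FI[of T] s T H01_zero_outside[OF F, of T] by (simp add: add_eq_0_iff2)
    moreover have "integral {s..T} (\<lambda>\<sigma>. cinner (w \<sigma>) (A x)) = - cinner (v s) (A x)"
      using integral_linear[OF w_int cinner.bounded_linear_left, of s "A x"] s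
      by (simp add: v_def o_def cinner.minus_left)
    moreover have "- cinner (w s) x = integral {s..T} (\<lambda>\<sigma>. g \<sigma> * cnj (Obs x) - cinner (w \<sigma>) (A x))"
      using backward_solution_increment[OF w g x, of s T] s by (simp add: wT cinner.zero_left)
    ultimately show ?thesis
      using Henstock_Kurzweil_Integration.integral_diff[OF gO wA] by simp
  qed
  have "backward_solution DA A Obs T F v"
    unfolding backward_solution_def
  proof (intro conjI ballI)
    have "v s = integral {0..s} w - integral {0..T} w" if "s \<in> {0..T}" for s
      using Henstock_Kurzweil_Integration.integral_combine[OF _ _ w_int, of 0 s] that
      by (simp add: v_def algebra_simps)
    then show "continuous_on {0..T} v"
      by (subst continuous_on_cong[OF refl])
         (auto intro!: continuous_intros indefinite_integral_continuous_1 w_int)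
    show "v T = 0"
      by (simp add: v_def)
    fix x t assume x: "x \<in> DA" and t: "t \<in> {0..T}"
    have "(LINT s:{t<..<T}|lborel. cinner (v s) (A x) - obs_adjoint Obs (F s) x)
        = (LINT s:{t<..<T}|lborel. - cinner (w s) x)"
      using t step[OF _ x]
      by (intro set_lebesgue_integral_cong) (auto simp: obs_adjoint_def cinner_complex_def)
    also have "\<dots> = integral {t..T} (\<lambda>s. - cinner (w s) x)"
      using t by (intro LINT_open_interval_eq_integral borel_integrable_atLeastAtMost'
          continuous_intros cinner.continuous_on continuous_on_subset[OF wc]) auto
    also have "\<dots> = cinner (v t) x"
      using integral_linear[OF w_int cinner.bounded_linear_left, of t x] t
      by (simp add: v_def o_def cinner.minus_left)
    finally show "cinner (v t) x
        = (LINT s:{t<..<T}|lborel. cinner (v s) (A x) - obs_adjoint Obs (F s) x)"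
      by simp
  qed
  then have "W F = v 0"
    using F by (intro W_eq H01_sq_integrable)
  then show ?thesis
    using step[OF _ x, of 0] T W H01_zero_outside[OF F, of 0] by (simp add: g_def)
qed

text \<open>\<open>W F' = - A\<^sup>* W F\<close> in root coordinates, with \<open>A\<close> moved to the root vectors.\<close>

lemma coord_wderiv:
  assumes F: "F \<in> H01 T" and j: "j \<in> {1..L k}"
  shows "coord (wderiv T F) k j = - (lam k * coord F k j + (if j = 1 then 0 else coord F k (j - 1)))"
proof -
  have "coord (wderiv T F) k j = - cinner (A (\<phi> k j)) (W F)"
    using W_wderiv[OF F \<phi>_dom[OF j]] unfolding coord_def
    by (metis cinner_commute complex_cnj_minus)
  then show ?thesis
    by (simp add: A_\<phi>[OF j] coord_def cinner_add_left cinner_scaleC_left cinner.zero_left)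
qed

lemma data_form_eq:
  assumes F: "F \<in> H01 T" and \<tau>: "\<tau> \<in> {0<..<T}"
  shows "data_form y T F \<tau> = - cinner (u (T - \<tau>)) (W F)"
    and "data_deriv_form y T F \<tau> = cinner (u (T - \<tau>)) (W (wderiv T F))"
proof -
  have r: "T - \<tau> \<in> {0..T}"
    using \<tau> by auto
  show "data_form y T F \<tau> = - cinner (u (T - \<tau>)) (W F)"
    unfolding data_form_def LINT_obs
    by (rule correlation_obs[OF H01_sq_integrable[OF F] H01_zero_outside[OF F] r])
  show "data_deriv_form y T F \<tau> = cinner (u (T - \<tau>)) (W (wderiv T F))"
    unfolding data_deriv_form_def LINT_obs
    using correlation_obs[OF sq_integrable_wderiv[OF F] wderiv_zero_outside[OF F] r] by simp
qed


section \<open>Completeness of the trajectory of a generic source\<close>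

lemma c_eq:
  assumes i: "i \<in> {1..L k}"
  shows "cinner a (\<psi> k i) = c k i"
proof -
  let ?I = "SIGMA k:UNIV. {1..L k}"
  let ?g = "\<lambda>p. cinner (case p of (l, j) \<Rightarrow> c l j *\<^sub>C \<phi> l j) (\<psi> k i)"
  have "(?g has_sum cinner a (\<psi> k i)) ?I"
    using has_sum_bounded_linear[OF cinner.bounded_linear_left expansion] .
  moreover have "(?g has_sum c k i) ?I"
    by (rule has_sum_finite_neutralI[of "{(k, i)}"])
       (use i biorthogonal in \<open>auto simp: cinner_scaleC_left split: if_splits\<close>)
  ultimately show ?thesis
    by (rule has_sum_unique)
qed

lemma scalar_ode_unique:
  fixes d :: "real \<Rightarrow> complex"
  assumes deriv: "\<And>t. t \<in> {0..S} \<Longrightarrow> (d has_vector_derivative l * d t) (at t within {0..S})"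
    and "d 0 = 0" and t: "t \<in> {0..S}"
  shows "d t = 0"
proof -
  have E: "((\<lambda>t. exp (- l * of_real t)) has_vector_derivative - l * exp (- l * of_real t)) (at t within {0..S})"
    for t
  proof -
    have "((\<lambda>z. exp (- l * z)) has_field_derivative - l * exp (- l * z)) (at z)" for z
      by (auto intro!: derivative_eq_intros)
    from has_vector_derivative_real_field[OF this, of t] show ?thesis
      by (auto intro: has_vector_derivative_at_within simp: o_def)
  qed
  have const: "((\<lambda>t. exp (- l * of_real t) * d t) has_vector_derivative 0) (at t within {0..S})"
    if "t \<in> {0..S}" for t
    using has_vector_derivative_mult[OF E deriv[OF that]] by (simp add: algebra_simps)
  obtain b where "\<And>t. t \<in> {0..S} \<Longrightarrow> exp (- l * of_real t) * d t = b"
    using has_vector_derivative_zero_constant[OF convex_real_interval(5) const] by blast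
  from this[of 0] this[OF t] show ?thesis
    using \<open>d 0 = 0\<close> t by auto
qed

text \<open>The coordinates of a chain form a triangular system of scalar equations, solved from the last
  one, \<open>j = L k\<close>, downwards.\<close>

lemma u_coordinates:
  assumes j: "j \<in> {1..L k}" and t: "t \<in> {0..T}"
  shows "cinner (u t) (\<psi> k j) = (\<Sum>m\<le>L k - j. chain_fun k m t * c k (j + m))"
  using assms
proof (induction "L k - j" arbitrary: j t rule: less_induct)
  case less
  note j = less.prems(1)
  define q where "q j t = (\<Sum>m\<le>L k - j. chain_fun k m t * c k (j + m))" for j t
  define p where "p j t = cinner (u t) (\<psi> k j)" for j t
  have p_eq: "p j t = c k j + lam k * cinner (u_integral t) (\<psi> k j)
      + (if j = L k then 0 else cinner (u_integral t) (\<psi> k (j + 1)))" if "t \<ge> 0" for t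
  proof -
    have "u t = a + A (u_integral t)"
      using u_integral(2)[OF that] by simp
    then show ?thesis
      using adjoint_\<psi>[OF j u_integral(1)[OF that]] c_eq[OF j] by (simp add: p_def cinner_add_left)
  qed
  have p_deriv: "(p j has_vector_derivative lam k * p j t + (if j = L k then 0 else p (j + 1) t))
      (at t within {0..T})" if t: "t \<in> {0..T}" for t
  proof -
    have next_deriv: "((\<lambda>t. if j = L k then 0 else cinner (u_integral t) (\<psi> k (j + 1)))
        has_vector_derivative (if j = L k then 0 else cinner (u t) (\<psi> k (j + 1)))) (at t within {0..T})"
      by (cases "j = L k")
         (auto intro!: bounded_linear.has_vector_derivative[OF cinner.bounded_linear_left]
          u_integral_deriv simp: t[simplified])
    have "((\<lambda>t. c k j + lam k * cinner (u_integral t) (\<psi> k j)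
        + (if j = L k then 0 else cinner (u_integral t) (\<psi> k (j + 1)))) has_vector_derivative
        0 + lam k * p j t + (if j = L k then 0 else p (j + 1) t)) (at t within {0..T})"
      unfolding p_def
      by (intro has_vector_derivative_add has_vector_derivative_const next_deriv
          bounded_linear.has_vector_derivative[OF bounded_linear_mult_right]
          bounded_linear.has_vector_derivative[OF cinner.bounded_linear_left] u_integral_deriv t)
    then have "(p j has_vector_derivative
        0 + lam k * p j t + (if j = L k then 0 else p (j + 1) t)) (at t within {0..T})"
      by (rule has_vector_derivative_transform[OF t, rotated]) (use p_eq in auto)
    then show ?thesis
      by (simp only: add_0_left)
  qed
  have q_deriv: "(q j has_vector_derivative lam k * q j t + (if j = L k then 0 else q (j + 1) t))
      (at t within {0..T})" for t
  proof -
    define e where "e m = (if m = 0 then 0 else chain_fun k (m - 1) t)" for m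
    have "(q j has_vector_derivative
        (\<Sum>m\<le>L k - j. (lam k * chain_fun k m t + e m) * c k (j + m))) (at t within {0..T})"
      unfolding q_def e_def
      by (intro has_vector_derivative_sum chain_fun_deriv
          bounded_linear.has_vector_derivative[OF bounded_linear_mult_left])
    also have "(\<Sum>m\<le>L k - j. (lam k * chain_fun k m t + e m) * c k (j + m))
        = lam k * q j t + (\<Sum>m\<le>L k - j. e m * c k (j + m))"
      by (simp add: q_def algebra_simps sum.distrib sum_distrib_left)
    also have "(\<Sum>m\<le>L k - j. e m * c k (j + m)) = (if j = L k then 0 else q (j + 1) t)"
    proof (cases "j = L k")
      case False
      then have "L k - j = Suc (L k - (j + 1))"
        using j by auto
      then show ?thesis
        using False by (simp only: sum.atMost_Suc_shift) (simp add: e_def q_def)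
    qed (simp add: e_def)
    finally show ?thesis .
  qed
  have next_eq: "p (j + 1) t = q (j + 1) t" if "j \<noteq> L k" "t \<in> {0..T}" for t
    unfolding p_def q_def using that j by (intro less.hyps) auto
  have "p j t - q j t = 0"
  proof (rule scalar_ode_unique[where d = "\<lambda>t. p j t - q j t" and S = T and l = "lam k"])
    fix t assume t: "t \<in> {0..T}"
    show "((\<lambda>t. p j t - q j t) has_vector_derivative lam k * (p j t - q j t)) (at t within {0..T})"
      using has_vector_derivative_diff[OF p_deriv[OF t] q_deriv[of t]] next_eq[OF _ t]
      by (auto simp: algebra_simps split: if_splits)
  next
    have "q j 0 = (\<Sum>m\<le>L k - j. if m = 0 then c k j else 0)"
      unfolding q_def by (intro sum.cong) (auto simp: chain_fun_0)
    then show "p j 0 - q j 0 = 0"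
      using p_eq[of 0] by (simp add: u_integral_def cinner.zero_left)
  qed (use less.prems in auto)
  then show ?case
    by (simp add: p_def q_def)
qed

definition moment :: "nat \<Rightarrow> nat \<Rightarrow> (real \<Rightarrow> complex) \<Rightarrow> complex" where
  "moment k m h = integral {0..T} (\<lambda>s. cnj (h s) * chain_fun k m s)"

lemma moment_integrable:
  assumes "sq_integrable h"
  shows "(\<lambda>s. cnj (h s) * chain_fun k m s) integrable_on {0..T}"
  by (intro set_borel_integral_eq_integral set_integrable_mult_continuous sq_integrable_cnj assms
      chain_fun_continuous)

lemma coord_eq_moments:
  assumes h: "sq_integrable h" and j: "j \<in> {1..L k}"
  shows "coord h k j = - (\<Sum>m<j. moment k m h * Obs (\<phi> k (j - m)))"
proof -
  have "integral {0..T} (\<lambda>s. cnj (h s) * root_observation k j s)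
      = integral {0..T} (\<lambda>s. \<Sum>m<j. cnj (h s) * chain_fun k m s * Obs (\<phi> k (j - m)))"
    by (simp add: root_observation_def sum_distrib_left mult.assoc)
  also have "\<dots> = (\<Sum>m<j. moment k m h * Obs (\<phi> k (j - m)))"
    unfolding moment_def
    by (subst Henstock_Kurzweil_Integration.integral_sum)
       (auto intro!: integrable_on_mult_left moment_integrable h)
  finally show ?thesis
    by (simp add: coord_eq[OF h j])
qed

lemma coord_f:
  assumes "i \<in> {1..L k}" "j \<in> {1..L l}"
  shows "coord (f k i) l j = (if l = k \<and> j = i then 1 else 0)"
  using biorthogonal[OF assms(2,1)] controllable[OF assms(1)] by (simp add: coord_def)

lemma f_H01: "i \<in> {1..L k} \<Longrightarrow> f k i \<in> H01 T"
  using controllable by blast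

lemma f_sq_integrable: "i \<in> {1..L k} \<Longrightarrow> sq_integrable (f k i)"
  using f_H01 H01_sq_integrable by blast

lemma one_mem: "1 \<in> {1..L k}"
  using L_pos[of k] by simp

text \<open>If the observation of an eigenvector vanished, then so would the corresponding coordinate of
  \<open>W h\<close> for every control \<open>h\<close>, in particular for the one that leads to \<open>\<psi> k 1\<close>.\<close>

lemma Obs_eigenvector_nonzero: "Obs (\<phi> k 1) \<noteq> 0"
  using coord_f[OF one_mem one_mem, of k k] coord_eq_moments[OF f_sq_integrable[OF one_mem] one_mem, of k k]
  by auto

text \<open>The moments solve a triangular system whose diagonal entry, the observation of the
  eigenvector, does not vanish.\<close>

lemma moment_f:
  assumes i: "i \<in> {1..L k}"
  shows "m < L l \<Longrightarrow> l \<noteq> k \<or> m + 1 < i \<Longrightarrow> moment l m (f k i) = 0"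
    and "moment k (i - 1) (f k i) \<noteq> 0"
proof -
  have leading: "coord (f k i) l (m + 1) = - moment l m (f k i) * Obs (\<phi> l 1)"
    if "m < L l" and "\<And>n. n < m \<Longrightarrow> moment l n (f k i) = 0" for l m
  proof -
    have "(\<Sum>n<m + 1. moment l n (f k i) * Obs (\<phi> l (m + 1 - n))) = moment l m (f k i) * Obs (\<phi> l 1)"
      using that(2) by simp
    then show ?thesis
      using coord_eq_moments[OF f_sq_integrable[OF i], of "m + 1" l] that(1) by simp
  qed
  have zero: "moment l m (f k i) = 0" if "m < L l" "l \<noteq> k \<or> m + 1 < i" for l m
    using that
  proof (induction m rule: less_induct)
    case (less m)
    have "coord (f k i) l (m + 1) = 0"
      using coord_f[OF i, of "m + 1" l] less.prems by auto
    moreover have "coord (f k i) l (m + 1) = - moment l m (f k i) * Obs (\<phi> l 1)"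
      using less by (intro leading) auto
    ultimately show ?case
      using Obs_eigenvector_nonzero by auto
  qed
  then show "m < L l \<Longrightarrow> l \<noteq> k \<or> m + 1 < i \<Longrightarrow> moment l m (f k i) = 0" .
  have "coord (f k i) k (i - 1 + 1) = - moment k (i - 1) (f k i) * Obs (\<phi> k 1)"
    using i zero by (intro leading) auto
  then show "moment k (i - 1) (f k i) \<noteq> 0"
    using coord_f[OF i i] i by auto
qed

definition weighted_trajectory :: "nat \<Rightarrow> nat \<Rightarrow> 'h" where
  "weighted_trajectory k i = integral {0..T} (\<lambda>s. cnj (f k i s) *\<^sub>C u s)"

lemma cinner_weighted_trajectory:
  assumes i: "i \<in> {1..L k}"
  shows "cinner (weighted_trajectory k i) x = integral {0..T} (\<lambda>s. cnj (f k i s) * cinner (u s) x)"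
proof -
  have "continuous_on {0..T} (\<lambda>s. cnj (f k i s) *\<^sub>C u s)"
    by (intro scaleC.continuous_on continuous_on_cnj u_continuous H01_continuous f_H01 i)
  from integral_linear[OF integrable_continuous_real[OF this] cinner.bounded_linear_left, of x]
  show ?thesis
    by (simp add: weighted_trajectory_def o_def cinner_scaleC_left)
qed

lemma weighted_trajectory_coordinates:
  assumes i: "i \<in> {1..L k}" and j: "j \<in> {1..L l}"
  shows "cinner (weighted_trajectory k i) (\<psi> l j)
       = (\<Sum>m\<le>L l - j. moment l m (f k i) * c l (j + m))"
proof -
  have "cinner (weighted_trajectory k i) (\<psi> l j)
      = integral {0..T} (\<lambda>s. \<Sum>m\<le>L l - j. cnj (f k i s) * chain_fun l m s * c l (j + m))"
    unfolding cinner_weighted_trajectory[OF i]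
    by (intro Henstock_Kurzweil_Integration.integral_cong)
       (simp add: u_coordinates[OF j] sum_distrib_left mult.assoc)
  also have "\<dots> = (\<Sum>m\<le>L l - j. moment l m (f k i) * c l (j + m))"
    unfolding moment_def
    by (subst Henstock_Kurzweil_Integration.integral_sum)
       (auto intro!: integrable_on_mult_left moment_integrable f_sq_integrable i)
  finally show ?thesis .
qed

text \<open>Among the coordinates of the mean with weight \<open>cnj (f k i)\<close>, those of the other eigenvalues
  and those beyond \<open>q = L k - i + 1\<close> contain only vanishing moments. In the coordinate \<open>q\<close> only the
  moment of order \<open>i - 1\<close> survives, multiplied by the last coefficient of the source.\<close>

lemma weighted_trajectory_eq:
  assumes q: "q \<in> {1..L k}"
  obtains \<zeta> where "\<zeta> q \<noteq> 0" "weighted_trajectory k (L k - q + 1) = (\<Sum>j=1..q. \<zeta> j *\<^sub>C \<phi> k j)"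
proof -
  define i where "i = L k - q + 1"
  have i: "i \<in> {1..L k}" and iq: "i - 1 = L k - q"
    using q by (auto simp: i_def)
  let ?z = "weighted_trajectory k i"
  define \<zeta> where "\<zeta> j = cinner ?z (\<psi> k j)" for j
  have coords: "cinner ?z (\<psi> l j) = (if l = k \<and> j \<le> q then \<zeta> j else 0)" if j: "j \<in> {1..L l}" for l j
  proof -
    have "cinner ?z (\<psi> l j) = 0" if "\<not> (l = k \<and> j \<le> q)"
      unfolding weighted_trajectory_coordinates[OF i j]
    proof (intro sum.neutral ballI)
      fix m assume "m \<in> {..L l - j}"
      then have "m < L l" "l \<noteq> k \<or> m + 1 < i"
        using that j q by (auto simp: i_def)
      then show "moment l m (f k i) * c l (j + m) = 0"
        using moment_f(1)[OF i] by auto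
    qed
    then show ?thesis
      by (auto simp: \<zeta>_def)
  qed
  have "\<zeta> q = (\<Sum>m\<le>L k - q. if m = i - 1 then moment k m (f k i) * c k (q + m) else 0)"
    unfolding \<zeta>_def weighted_trajectory_coordinates[OF i q]
    using moment_f(1)[OF i] q by (intro sum.cong) (auto simp: i_def)
  also have "\<dots> = moment k (i - 1) (f k i) * c k (L k)"
    unfolding iq using q by simp
  finally have "\<zeta> q \<noteq> 0"
    using moment_f(2)[OF i] generic[of "L k" k] q by auto
  moreover have "?z = (\<Sum>j=1..q. \<zeta> j *\<^sub>C \<phi> k j)"
  proof -
    have "cinner (?z - (\<Sum>j=1..q. \<zeta> j *\<^sub>C \<phi> k j)) (\<psi> l j) = 0" if j: "j \<in> {1..L l}" for l j
    proof -
      have "cinner (\<Sum>n=1..q. \<zeta> n *\<^sub>C \<phi> k n) (\<psi> l j) = (\<Sum>n=1..q. if l = k \<and> n = j then \<zeta> j else 0)"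
        unfolding cinner.sum_left using q j biorthogonal
        by (intro sum.cong) (auto simp: cinner_scaleC_left)
      also have "\<dots> = (if l = k \<and> j \<le> q then \<zeta> j else 0)"
        using j by (cases "l = k") auto
      finally show ?thesis
        by (simp add: cinner.diff_left coords[OF j])
    qed
    then have "?z - (\<Sum>j=1..q. \<zeta> j *\<^sub>C \<phi> k j) = 0"
      by (rule \<psi>_total)
    then show ?thesis
      by simp
  qed
  ultimately show ?thesis
    using that unfolding i_def by blast
qed

text \<open>A vector orthogonal to the trajectory is orthogonal to all its weighted means; these are
  triangular in the root vectors, which gives orthogonality to \<open>\<phi> k 1, \<phi> k 2, \<dots>\<close> in turn.\<close>

theorem trajectory_complete:
  assumes orth: "\<And>r. r \<in> {0<..<T} \<Longrightarrow> cinner (u r) x = 0"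
  shows "x = 0"
proof (rule \<phi>_total)
  fix k q assume "q \<in> {1..L k}"
  then show "cinner (\<phi> k q) x = 0"
  proof (induction q rule: less_induct)
    case (less q)
    define i where "i = L k - q + 1"
    have i: "i \<in> {1..L k}"
      using less.prems by (auto simp: i_def)
    obtain \<zeta> where \<zeta>: "\<zeta> q \<noteq> 0" "weighted_trajectory k i = (\<Sum>j=1..q. \<zeta> j *\<^sub>C \<phi> k j)"
      using weighted_trajectory_eq[OF less.prems] unfolding i_def by blast
    have "cinner (weighted_trajectory k i) x = integral {0..T} (\<lambda>s. 0)"
      unfolding cinner_weighted_trajectory[OF i]
    proof (intro Henstock_Kurzweil_Integration.integral_cong)
      fix s assume "s \<in> {0..T}"
      show "cnj (f k i s) * cinner (u s) x = 0"
        using orth[of s] H01_zero_outside[OF f_H01[OF i], of s] by (cases "s \<in> {0<..<T}") auto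
    qed
    then have "0 = (\<Sum>j=1..q. \<zeta> j * cinner (\<phi> k j) x)"
      by (simp add: \<zeta>(2) cinner.sum_left cinner_scaleC_left)
    also have "\<dots> = (\<Sum>j=1..q. if j = q then \<zeta> j * cinner (\<phi> k j) x else 0)"
      using less by (intro sum.cong) auto
    also have "\<dots> = \<zeta> q * cinner (\<phi> k q) x"
      using less.prems by simp
    finally show ?case
      using \<zeta>(1) by simp
  qed
qed

section \<open>The generalized spectral problem in root coordinates\<close>

lemma coord_zero: "j \<in> {1..L k} \<Longrightarrow> coord (\<lambda>_. 0) k j = 0"
  using coord_eq[OF H01_sq_integrable[OF H01_zero]] by simp

text \<open>By completeness of the trajectory the equation for all shifts \<open>\<tau>\<close> is the vector equation
  \<open>W F' + cnj \<mu> W F + W G = 0\<close>, stated here in coordinates.\<close>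

theorem chain_equation_iff:
  assumes F: "F \<in> H01 T" and G: "G \<in> H01 T"
  shows "(\<forall>\<tau>\<in>{0<..<T}. data_deriv_form y T F \<tau> - \<mu> * data_form y T F \<tau> = data_form y T G \<tau>)
     \<longleftrightarrow> (\<forall>k. \<forall>j\<in>{1..L k}.
            (lam k - \<mu>) * coord F k j + (if j = 1 then 0 else coord F k (j - 1)) = coord G k j)"
proof -
  define x where "x = W (wderiv T F) + cnj \<mu> *\<^sub>C W F + W G"
  have residual: "data_deriv_form y T F \<tau> - \<mu> * data_form y T F \<tau> - data_form y T G \<tau>
      = cinner (u (T - \<tau>)) x" if "\<tau> \<in> {0<..<T}" for \<tau>
    unfolding data_form_eq[OF F that] data_form_eq[OF G that] x_def
    by (simp add: cinner_add_right cinner_scaleC_right)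
  have coord_x: "cinner (\<phi> k j) x = coord G k j -
      ((lam k - \<mu>) * coord F k j + (if j = 1 then 0 else coord F k (j - 1)))"
    if "j \<in> {1..L k}" for k j
  proof -
    have "cinner (\<phi> k j) x = coord (wderiv T F) k j + \<mu> * coord F k j + coord G k j"
      by (simp add: x_def cinner_add_right cinner_scaleC_right coord_def)
    then show ?thesis
      unfolding coord_wderiv[OF F that] by (simp add: algebra_simps)
  qed
  have "(\<forall>\<tau>\<in>{0<..<T}. data_deriv_form y T F \<tau> - \<mu> * data_form y T F \<tau> = data_form y T G \<tau>)
      \<longleftrightarrow> (\<forall>\<tau>\<in>{0<..<T}. cinner (u (T - \<tau>)) x = 0)"
    using residual by (metis eq_iff_diff_eq_0)
  also have "\<dots> \<longleftrightarrow> x = 0"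
  proof
    assume orth: "\<forall>\<tau>\<in>{0<..<T}. cinner (u (T - \<tau>)) x = 0"
    have "cinner (u r) x = 0" if "r \<in> {0<..<T}" for r
      using orth[rule_format, of "T - r"] that by auto
    then show "x = 0"
      by (rule trajectory_complete)
  qed (simp add: cinner.zero_right)
  also have "\<dots> \<longleftrightarrow> (\<forall>k. \<forall>j\<in>{1..L k}. cinner (\<phi> k j) x = 0)"
    using \<phi>_total by (metis cinner.zero_right)
  also have "\<dots> \<longleftrightarrow> (\<forall>k. \<forall>j\<in>{1..L k}.
      (lam k - \<mu>) * coord F k j + (if j = 1 then 0 else coord F k (j - 1)) = coord G k j)"
    using coord_x by (metis (no_types, lifting) eq_iff_diff_eq_0)
  finally show ?thesis .
qed

lemma silent_iff:
  "F \<in> silent y T \<longleftrightarrow> F \<in> H01 T \<and> (\<forall>k. \<forall>j\<in>{1..L k}. coord F k j = 0)"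
proof (cases "F \<in> H01 T")
  case True
  have "F \<in> silent y T \<longleftrightarrow> (\<forall>\<tau>\<in>{0<..<T}. cinner (u (T - \<tau>)) (W F) = 0)"
    using True by (auto simp: silent_def data_form_eq)
  also have "\<dots> \<longleftrightarrow> W F = 0"
  proof
    assume orth: "\<forall>\<tau>\<in>{0<..<T}. cinner (u (T - \<tau>)) (W F) = 0"
    have "cinner (u r) (W F) = 0" if "r \<in> {0<..<T}" for r
      using orth[rule_format, of "T - r"] that by auto
    then show "W F = 0"
      by (rule trajectory_complete)
  qed (simp add: cinner.zero_right)
  also have "\<dots> \<longleftrightarrow> (\<forall>k. \<forall>j\<in>{1..L k}. coord F k j = 0)"
    using \<phi>_total by (metis cinner.zero_right coord_def)
  finally show ?thesis
    using True by simp
qed (simp add: silent_def)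

lemma zero_silent: "(\<lambda>_. 0) \<in> silent y T"
  by (simp add: silent_iff H01_zero coord_zero)

lemma data_form_zero: "data_form y T (\<lambda>_. 0) \<tau> = 0"
  by (simp add: data_form_def cinner_complex_def set_lebesgue_integral_def)


text \<open>Combinations of the controls realise any prescribed finite set of coordinates of one
  eigenvalue; \<open>n\<close> will be either silent or a control to be corrected.\<close>

lemma combination_of_f:
  assumes n: "n \<in> H01 T" and "finite J" and J: "J \<subseteq> {1..L k}"
  shows "(\<lambda>t. (\<Sum>j\<in>J. b j * f k j t) + n t) \<in> H01 T"
    and "i \<in> {1..L l} \<Longrightarrow> coord (\<lambda>t. (\<Sum>j\<in>J. b j * f k j t) + n t) l i
       = (if l = k \<and> i \<in> J then cnj (b i) else 0) + coord n l i"
proof -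
  have "(\<lambda>t. (\<Sum>j\<in>J. b j * f k j t) + n t) \<in> H01 T \<and>
      (\<forall>l. \<forall>i\<in>{1..L l}. coord (\<lambda>t. (\<Sum>j\<in>J. b j * f k j t) + n t) l i
       = (if l = k \<and> i \<in> J then cnj (b i) else 0) + coord n l i)"
    using \<open>finite J\<close> J
  proof (induction J)
    case (insert j J)
    let ?G = "\<lambda>t. (\<Sum>j\<in>J. b j * f k j t) + n t"
    have j: "j \<in> {1..L k}" and G: "?G \<in> H01 T"
      using insert by auto
    have eq: "(\<lambda>t. (\<Sum>j\<in>insert j J. b j * f k j t) + n t) = (\<lambda>t. ?G t + b j * f k j t)"
      using insert by (simp add: algebra_simps)
    have H: "(\<lambda>t. ?G t + b j * f k j t) \<in> H01 T"
      by (intro H01_add_scale G f_H01 j)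
    have "coord (\<lambda>t. ?G t + b j * f k j t) l i
        = (if l = k \<and> i \<in> insert j J then cnj (b i) else 0) + coord n l i"
      if i: "i \<in> {1..L l}" for l i
      using coord_add_scale[OF H01_sq_integrable[OF G] f_sq_integrable[OF j]
          H01_sq_integrable[OF H] i] coord_f[OF j i] insert i
      by auto
    then show ?case
      unfolding eq using H by blast
  qed (use n in simp)
  then show "(\<lambda>t. (\<Sum>j\<in>J. b j * f k j t) + n t) \<in> H01 T"
    and "i \<in> {1..L l} \<Longrightarrow> coord (\<lambda>t. (\<Sum>j\<in>J. b j * f k j t) + n t) l i
       = (if l = k \<and> i \<in> J then cnj (b i) else 0) + coord n l i"
    by blast+
qed

text \<open>The convention that the chain ends with zero is absorbed by the zero control on the right-hand
  side.\<close>

lemma gen_root_chain_iff: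
  "gen_root_chain y T Z \<mu> M F \<longleftrightarrow> 1 \<le> M \<and> F M \<notin> Z \<and> (\<forall>i\<in>{1..M}. F i \<in> H01 T \<and>
     (\<forall>k. \<forall>j\<in>{1..L k}. (lam k - \<mu>) * coord (F i) k j + (if j = 1 then 0 else coord (F i) k (j - 1))
        = (if i < M then coord (F (i + 1)) k j else 0)))"
proof -
  define P where "P i \<longleftrightarrow> (\<forall>\<tau>\<in>{0<..<T}. data_deriv_form y T (F i) \<tau> - \<mu> * data_form y T (F i) \<tau> =
      (if i < M then data_form y T (F (i + 1)) \<tau> else 0))" for i
  define Q where "Q i \<longleftrightarrow> (\<forall>k. \<forall>j\<in>{1..L k}.
      (lam k - \<mu>) * coord (F i) k j + (if j = 1 then 0 else coord (F i) k (j - 1))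
        = (if i < M then coord (F (i + 1)) k j else 0))" for i
  have PQ: "P i \<longleftrightarrow> Q i" if i: "i \<in> {1..M}" and H: "\<forall>i\<in>{1..M}. F i \<in> H01 T" for i
  proof (cases "i < M")
    case True
    then show ?thesis
      using chain_equation_iff[of "F i" "F (i + 1)" \<mu>] i H by (simp add: P_def Q_def)
  next
    case False
    then show ?thesis
      using chain_equation_iff[of "F i" "\<lambda>_. 0" \<mu>] i H H01_zero
      by (simp add: data_form_zero coord_zero P_def Q_def)
  qed
  have "gen_root_chain y T Z \<mu> M F \<longleftrightarrow> 1 \<le> M \<and> F M \<notin> Z \<and> (\<forall>i\<in>{1..M}. F i \<in> H01 T \<and> P i)"
    unfolding gen_root_chain_def P_def ..
  also have "\<dots> \<longleftrightarrow> 1 \<le> M \<and> F M \<notin> Z \<and> (\<forall>i\<in>{1..M}. F i \<in> H01 T \<and> Q i)"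
    by (intro conj_cong refl) (metis PQ)
  finally show ?thesis
    unfolding Q_def .
qed

lemma gen_spectrum_iff:
  "\<mu> \<in> gen_spectrum y T Z \<longleftrightarrow> (\<exists>F\<in>H01 T. F \<notin> Z \<and>
     (\<forall>k. \<forall>j\<in>{1..L k}. (lam k - \<mu>) * coord F k j + (if j = 1 then 0 else coord F k (j - 1)) = 0))"
proof -
  have "(\<forall>\<tau>\<in>{0<..<T}. data_deriv_form y T F \<tau> - \<mu> * data_form y T F \<tau> = 0) \<longleftrightarrow>
      (\<forall>k. \<forall>j\<in>{1..L k}. (lam k - \<mu>) * coord F k j + (if j = 1 then 0 else coord F k (j - 1)) = 0)"
    if "F \<in> H01 T" for F
    using chain_equation_iff[OF that H01_zero, of \<mu>] by (simp add: data_form_zero coord_zero)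
  then show ?thesis
    unfolding gen_spectrum_def by blast
qed

lemma f_not_silent: "i \<in> {1..L k} \<Longrightarrow> f k i \<notin> silent y T"
  using coord_f[of i k i k] unfolding silent_iff by (metis zero_neq_one)

lemma f_root_chain:
  assumes "Z \<subseteq> silent y T"
  shows "gen_root_chain y T Z (lam k) (L k) (f k)"
  unfolding gen_root_chain_iff
proof (intro conjI ballI allI)
  show "1 \<le> L k"
    by (rule L_pos)
  then show "f k (L k) \<notin> Z"
    using f_not_silent[of "L k" k] assms by auto
  fix i assume i: "i \<in> {1..L k}"
  then show "f k i \<in> H01 T"
    by (rule f_H01)
  fix l j assume j: "j \<in> {1..L l}"
  have "coord (f k i) l (j - 1) = (if l = k \<and> j = i + 1 then 1 else 0)" if "j \<noteq> 1"
  proof -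
    have "j - 1 \<in> {1..L l}" "j - 1 = i \<longleftrightarrow> j = i + 1"
      using that j by auto
    then show ?thesis
      using coord_f[OF i] by simp
  qed
  moreover have "i < L k \<Longrightarrow> coord (f k (i + 1)) l j = (if l = k \<and> j = i + 1 then 1 else 0)"
    using i j by (intro coord_f) auto
  moreover have "coord (f k i) l j = (if l = k \<and> j = i then 1 else 0)"
    using i j by (rule coord_f)
  ultimately show "(lam l - lam k) * coord (f k i) l j + (if j = 1 then 0 else coord (f k i) l (j - 1))
      = (if i < L k then coord (f k (i + 1)) l j else 0)"
    using i j by auto
qed

lemma lam_in_gen_spectrum: "lam k \<in> gen_spectrum y T (silent y T)"
proof -
  have "gen_root_chain y T (silent y T) (lam k) (L k) (f k)"
    by (rule f_root_chain) simp
  then show ?thesis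
    using L_pos[of k] unfolding gen_root_chain_def gen_spectrum_def by fastforce
qed

text \<open>For the converse inclusion consider the first nonvanishing coordinate of an eigenvector for
  some eigenvalue \<open>lam k\<close>: the recursion reduces to \<open>(lam k - \<mu>) coord F k j = 0\<close> there.\<close>

theorem gen_spectrum_modulo_silent: "gen_spectrum y T (silent y T) = range lam"
proof
  show "range lam \<subseteq> gen_spectrum y T (silent y T)"
    using lam_in_gen_spectrum by blast
  show "gen_spectrum y T (silent y T) \<subseteq> range lam"
  proof
    fix \<mu> assume "\<mu> \<in> gen_spectrum y T (silent y T)"
    then obtain F where F: "F \<in> H01 T" "F \<notin> silent y T"
      and eq: "\<And>k j. j \<in> {1..L k} \<Longrightarrow>
        (lam k - \<mu>) * coord F k j + (if j = 1 then 0 else coord F k (j - 1)) = 0"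
      unfolding gen_spectrum_iff by blast
    obtain k where ex: "\<exists>j. j \<in> {1..L k} \<and> coord F k j \<noteq> 0"
      using F unfolding silent_iff by blast
    define j where "j = (LEAST j. j \<in> {1..L k} \<and> coord F k j \<noteq> 0)"
    have j: "j \<in> {1..L k}" "coord F k j \<noteq> 0"
      using LeastI_ex[OF ex] by (auto simp: j_def)
    have "j = 1 \<or> coord F k (j - 1) = 0"
      using not_less_Least[of "j - 1" "\<lambda>j. j \<in> {1..L k} \<and> coord F k j \<noteq> 0", folded j_def] j(1)
      by auto
    then have "(lam k - \<mu>) * coord F k j = 0"
      using eq[OF j(1)] by (cases "j = 1") (simp_all del: One_nat_def)
    then show "\<mu> \<in> range lam"
      using j(2) by auto
  qed
qed

text \<open>Members of a chain at \<open>lam k\<close> have no coordinates at the other eigenvalues, by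
  induction down the chain and up the coordinates, as \<open>lam l - lam k \<noteq> 0\<close> can be cancelled. None of
  them is silent, since a silent member would make the next one silent, up to the eigenvector.\<close>

lemma gen_root_chain_coords:
  assumes chain: "gen_root_chain y T (silent y T) (lam k) M F" and i: "i \<in> {1..M}"
  shows "F i \<in> H01 T"
    and "l \<noteq> k \<Longrightarrow> j \<in> {1..L l} \<Longrightarrow> coord (F i) l j = 0"
    and "\<exists>j\<in>{1..L k}. coord (F i) k j \<noteq> 0"
proof -
  have H: "F i \<in> H01 T" if "i \<in> {1..M}" for i
    using chain that by (auto simp: gen_root_chain_iff)
  then show "F i \<in> H01 T"
    using i .
  have eq: "(lam l - lam k) * coord (F i) l j + (if j = 1 then 0 else coord (F i) l (j - 1))
      = (if i < M then coord (F (i + 1)) l j else 0)" if "i \<in> {1..M}" "j \<in> {1..L l}" for i l j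
    using chain that unfolding gen_root_chain_iff by blast
  have zero: "coord (F i) l j = 0" if l: "l \<noteq> k" and "i \<in> {1..M}" "j \<in> {1..L l}" for i l j
    using that(2,3)
  proof (induction "M - i" arbitrary: i j rule: less_induct)
    case less
    note outer = less.hyps
    from less.prems(2,1) show ?case
    proof (induction j rule: less_induct)
      case (less j)
      have "i < M \<Longrightarrow> coord (F (i + 1)) l j = 0"
        using less.prems by (intro outer) auto
      moreover have "j \<noteq> 1 \<Longrightarrow> coord (F i) l (j - 1) = 0"
        using less.prems by (intro less.IH) auto
      ultimately have "(lam l - lam k) * coord (F i) l j = 0"
        using eq[OF less.prems(2,1)] by (auto split: if_splits)
      then show ?case
        using inj_lam l by (auto dest: injD)
    qed
  qed
  then show "l \<noteq> k \<Longrightarrow> j \<in> {1..L l} \<Longrightarrow> coord (F i) l j = 0"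
    using i by blast
  show "\<exists>j\<in>{1..L k}. coord (F i) k j \<noteq> 0"
    using i
  proof (induction "M - i" arbitrary: i rule: less_induct)
    case less
    show ?case
    proof (cases "i < M")
      case True
      then have "\<exists>j\<in>{1..L k}. coord (F (i + 1)) k j \<noteq> 0"
        by (intro less.hyps) auto
      then obtain j where j: "j \<in> {1..L k}" "coord (F (i + 1)) k j \<noteq> 0"
        by blast
      have "j \<noteq> 1 \<and> coord (F i) k (j - 1) \<noteq> 0"
        using eq[OF less.prems j(1)] j(2) True by (auto split: if_splits)
      then show ?thesis
        using j(1) by (intro bexI[of _ "j - 1"]) auto
    next
      case False
      then have "F i \<notin> silent y T"
        using chain less.prems by (auto simp: gen_root_chain_iff)
      then show ?thesis
        using H[OF less.prems] zero[OF _ less.prems] by (fastforce simp: silent_iff)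
    qed
  qed
qed

text \<open>The coordinates of a root vector at its eigenvalue determine the combination of controls; what
  is left over has no coordinates at all.\<close>

lemma gen_root_vectors_decomposition:
  assumes "g \<in> gen_root_vectors y T (silent y T) (lam k)"
  shows "\<exists>b n. n \<in> silent y T \<and> (\<exists>j\<in>{1..L k}. b j \<noteq> 0) \<and>
           g = (\<lambda>t. (\<Sum>j=1..L k. b j * f k j t) + n t)"
proof -
  obtain M F i where chain: "gen_root_chain y T (silent y T) (lam k) M F"
    and i: "i \<in> {1..M}" and g: "g = F i"
    using assms unfolding gen_root_vectors_def by blast
  note coords = gen_root_chain_coords[OF chain i, folded g]
  define b where "b j = cnj (coord g k j)" for j
  define n where "n t = (\<Sum>j=1..L k. - b j * f k j t) + g t" for t
  have "n \<in> silent y T"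
    unfolding silent_iff
  proof (intro conjI allI ballI)
    note combination = combination_of_f[OF coords(1), where J = "{1..L k}" and k = k
        and b = "\<lambda>j. - b j", folded n_def[abs_def]]
    show "n \<in> H01 T"
      by (rule combination(1)) auto
    fix l j assume j: "j \<in> {1..L l}"
    have "coord n l j = (if l = k \<and> j \<in> {1..L k} then cnj (- b j) else 0) + coord g l j"
      by (rule combination(2)[OF _ _ j]) auto
    then show "coord n l j = 0"
      using coords(2)[OF _ j] j by (cases "l = k") (auto simp: b_def)
  qed
  moreover have "\<exists>j\<in>{1..L k}. b j \<noteq> 0"
    using coords(3) by (simp add: b_def)
  moreover have "g = (\<lambda>t. (\<Sum>j=1..L k. b j * f k j t) + n t)"
    by (simp add: n_def sum_negf)
  ultimately show ?thesis
    by blast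
qed

text \<open>Along the chain that starts with the given combination the coefficients move up by one index
  per step. If \<open>b m\<close> is the first nonzero one, the chain has \<open>L k - m + 1\<close> members and ends with
  \<open>b m * f k (L k)\<close>, or with the combination itself if \<open>m = L k\<close>. The silent part may stay in the
  first member because its coordinates vanish.\<close>

lemma combination_is_root_vector:
  assumes n: "n \<in> silent y T" and b: "\<exists>j\<in>{1..L k}. b j \<noteq> 0"
  shows "(\<lambda>t. (\<Sum>j=1..L k. b j * f k j t) + n t) \<in> gen_root_vectors y T (silent y T) (lam k)"
proof -
  define m where "m = (LEAST j. j \<in> {1..L k} \<and> b j \<noteq> 0)"
  have m: "m \<in> {1..L k}" "b m \<noteq> 0"
    using LeastI_ex[of "\<lambda>j. j \<in> {1..L k} \<and> b j \<noteq> 0"] b unfolding m_def by blast+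
  have below_m: "b j = 0" if "j \<in> {1..L k}" "j < m" for j
    using not_less_Least[of j "\<lambda>j. j \<in> {1..L k} \<and> b j \<noteq> 0"] that by (auto simp: m_def)
  define M where "M = L k - m + 1"
  define F where "F i = (\<lambda>t. (\<Sum>j=i..L k. b (j - i + 1) * f k j t) + (if i = 1 then n t else 0))" for i
  have H: "F i \<in> H01 T" and coord_F: "\<And>l q. q \<in> {1..L l} \<Longrightarrow>
      coord (F i) l q = (if l = k \<and> i \<le> q then cnj (b (q - i + 1)) else 0)" if i: "1 \<le> i" for i
  proof -
    let ?n = "\<lambda>t. if i = 1 then n t else 0"
    have n': "?n \<in> silent y T"
      using n zero_silent by (cases "i = 1") auto
    then have "?n \<in> H01 T"
      by (simp add: silent_iff)
    from combination_of_f[OF this, where J = "{i..L k}" and k = k and b = "\<lambda>j. b (j - i + 1)"] n' i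
    show "F i \<in> H01 T" and "\<And>l q. q \<in> {1..L l} \<Longrightarrow>
        coord (F i) l q = (if l = k \<and> i \<le> q then cnj (b (q - i + 1)) else 0)"
      unfolding F_def silent_iff by auto
  qed
  have "gen_root_chain y T (silent y T) (lam k) M F"
    unfolding gen_root_chain_iff
  proof (intro conjI ballI allI)
    show "1 \<le> M"
      by (simp add: M_def)
    have "coord (F M) k (L k) \<noteq> 0"
      using coord_F[of M "L k" k] m by (auto simp: M_def)
    then show "F M \<notin> silent y T"
      using m unfolding silent_iff by (meson L_pos atLeastAtMost_iff order.refl)
    fix i assume i: "i \<in> {1..M}"
    then show "F i \<in> H01 T"
      by (intro H) simp
    fix l q assume q: "q \<in> {1..L l}"
    have prev: "(if q = 1 then 0 else coord (F i) l (q - 1))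
        = (if l = k \<and> i + 1 \<le> q then cnj (b (q - i)) else 0)"
    proof (cases "q = 1")
      case False
      then have "q - 1 \<in> {1..L l}" "i \<le> q - 1 \<longleftrightarrow> i + 1 \<le> q" "i + 1 \<le> q \<Longrightarrow> q - 1 - i + 1 = q - i"
        using q by auto
      then show ?thesis
        using coord_F[of i "q - 1" l] i False by auto
    qed (use i in auto)
    have "(lam l - lam k) * coord (F i) l q = 0"
      using coord_F[of i q l] i q by auto
    moreover have "b (q - i) = 0" if "l = k" "i = M" "i + 1 \<le> q"
      using that q m by (intro below_m) (auto simp: M_def)
    moreover have "coord (F (i + 1)) l q = (if l = k \<and> i + 1 \<le> q then cnj (b (q - i)) else 0)"
      using coord_F[of "i + 1" q l] q by (auto simp: Suc_diff_Suc)
    ultimately show "(lam l - lam k) * coord (F i) l q + (if q = 1 then 0 else coord (F i) l (q - 1))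
        = (if i < M then coord (F (i + 1)) l q else 0)"
      unfolding prev using i by auto
  qed
  moreover have "F 1 = (\<lambda>t. (\<Sum>j=1..L k. b j * f k j t) + n t)"
    unfolding F_def by (intro ext) (auto intro!: sum.cong)
  moreover have "1 \<in> {1..M}"
    by (simp add: M_def)
  ultimately show ?thesis
    unfolding gen_root_vectors_def by (metis (mono_tags, lifting) image_eqI mem_Collect_eq)
qed

theorem gen_root_vectors_modulo_silent:
  "gen_root_vectors y T (silent y T) (lam k) =
     {g. \<exists>b n. n \<in> silent y T \<and> (\<exists>j\<in>{1..L k}. b j \<noteq> 0) \<and>
             g = (\<lambda>t. (\<Sum>j=1..L k. b j * f k j t) + n t)}"
proof (intro set_eqI iffI)
  fix g assume "g \<in> gen_root_vectors y T (silent y T) (lam k)"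
  then show "g \<in> {g. \<exists>b n. n \<in> silent y T \<and> (\<exists>j\<in>{1..L k}. b j \<noteq> 0) \<and>
             g = (\<lambda>t. (\<Sum>j=1..L k. b j * f k j t) + n t)}"
    using gen_root_vectors_decomposition by blast
qed (use combination_is_root_vector in blast)

text \<open>A nonzero silent control satisfies the equation for every \<open>\<mu>\<close>, with both forms zero.\<close>

lemma gen_spectrum_with_silent:
  assumes "silent y T \<noteq> {\<lambda>_. 0}"
  shows "gen_spectrum y T {\<lambda>_. 0} = UNIV"
proof -
  obtain n where n: "n \<in> silent y T" "n \<noteq> (\<lambda>_. 0)"
    using assms zero_silent by blast
  have "\<mu> \<in> gen_spectrum y T {\<lambda>_. 0}" for \<mu>
    unfolding gen_spectrum_iff
  proof (intro bexI conjI allI ballI)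
    fix k j assume j: "j \<in> {1..L k}"
    have "coord n k i = 0" if "i \<in> {1..L k}" for i
      using n(1) that unfolding silent_iff by blast
    moreover have "j \<noteq> 1 \<Longrightarrow> j - 1 \<in> {1..L k}"
      using j by auto
    ultimately have "coord n k j = 0" "j \<noteq> 1 \<Longrightarrow> coord n k (j - 1) = 0"
      using j by blast+
    then show "(lam k - \<mu>) * coord n k j + (if j = 1 then 0 else coord n k (j - 1)) = 0"
      by simp
  qed (use n in \<open>auto simp: silent_iff\<close>)
  then show ?thesis
    by blast
qed

end

theorem theorem1:
  fixes T :: real
    and DA DO :: "'h::complex_hilbert set"
    and A :: "'h \<Rightarrow> 'h" and Obs :: "'h \<Rightarrow> complex"
    and lam :: "nat \<Rightarrow> complex" and L :: "nat \<Rightarrow> nat"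
    and \<phi> \<psi> :: "nat \<Rightarrow> nat \<Rightarrow> 'h"
    and f :: "nat \<Rightarrow> nat \<Rightarrow> real \<Rightarrow> complex"
    and a :: 'h and c :: "nat \<Rightarrow> nat \<Rightarrow> complex"
    and u :: "real \<Rightarrow> 'h" and y :: "real \<Rightarrow> complex"
  assumes T: "T > 0"
    and A: "linear_on DA A"
    and Obs: "linear_on DO Obs" "DA \<subseteq> DO"
    and spectrum: "op_spectrum DA A = range lam" "inj lam"
    and multiplicity: "\<And>k. 1 \<le> L k" "\<And>k. alg_mult DA A (lam k) = L k"
    and \<phi>_dom: "\<And>k i. i \<in> {1..L k} \<Longrightarrow> \<phi> k i \<in> DA"
    and \<phi>_eigen: "\<And>k. A (\<phi> k 1) - lam k *\<^sub>C \<phi> k 1 = 0"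
    and \<phi>_chain: "\<And>k i. i \<in> {2..L k} \<Longrightarrow> A (\<phi> k i) - lam k *\<^sub>C \<phi> k i = \<phi> k (i - 1)"
    and \<phi>_riesz: "riesz_basis (SIGMA k:UNIV. {1..L k}) (\<lambda>(k, i). \<phi> k i)"
    and \<psi>_dom: "\<And>k i. i \<in> {1..L k} \<Longrightarrow> \<psi> k i \<in> adj_dom DA A"
    and \<psi>_eigen: "\<And>k. adj_op DA A (\<psi> k (L k)) - cnj (lam k) *\<^sub>C \<psi> k (L k) = 0"
    and \<psi>_chain: "\<And>k i. i \<in> {1..<L k} \<Longrightarrow>
                    adj_op DA A (\<psi> k i) - cnj (lam k) *\<^sub>C \<psi> k i = \<psi> k (i + 1)"
    and \<psi>_riesz: "riesz_basis (SIGMA k:UNIV. {1..L k}) (\<lambda>(k, i). \<psi> k i)"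
    and biorthogonal: "\<And>k i l j. i \<in> {1..L k} \<Longrightarrow> j \<in> {1..L l} \<Longrightarrow>
                         cinner (\<phi> k i) (\<psi> l j) = (if k = l \<and> i = j then 1 else 0)"
    and control_system: "\<And>g. g \<in> L2_on {0<..<T} \<Longrightarrow> \<exists>v. backward_solution DA A Obs T g v"
    and controllable: "\<And>k i. i \<in> {1..L k} \<Longrightarrow>
                         f k i \<in> H01 T \<and> control_op DA A Obs T 0 (f k i) = \<psi> k i"
    and expansion: "((\<lambda>(k, i). c k i *\<^sub>C \<phi> k i) has_sum a) (SIGMA k:UNIV. {1..L k})"
    and generic: "\<And>k i. i \<in> {1..L k} \<Longrightarrow> c k i \<noteq> 0"
    and u: "mild_solution DA A a u"
    and y: "is_observation Obs (2 * T) u y"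
  shows "(\<forall>k. gen_root_chain y T {\<lambda>_. 0} (lam k) (L k) (f k)) \<and>
    gen_spectrum y T (silent y T) = range lam \<and>
    (\<forall>k. gen_root_vectors y T (silent y T) (lam k) =
       {g. \<exists>b n. n \<in> silent y T \<and> (\<exists>j\<in>{1..L k}. b j \<noteq> 0) \<and>
               g = (\<lambda>t. (\<Sum>j=1..L k. b j * f k j t) + n t)}) \<and>
    gen_spectrum y T {\<lambda>_. 0} = (if silent y T = {\<lambda>_. 0} then range lam else UNIV) \<and>
    (silent y T = {\<lambda>_. 0} \<longrightarrow>
       (\<forall>k. gen_root_vectors y T {\<lambda>_. 0} (lam k) =
         {g. \<exists>b. (\<exists>j\<in>{1..L k}. b j \<noteq> 0) \<and> g = (\<lambda>t. \<Sum>j=1..L k. b j * f k j t)}))"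
proof -
  interpret observed_system T DA DO A Obs lam L \<phi> \<psi> f a c u y
    by unfold_locales (fact assms)+
  have chain: "gen_root_chain y T {\<lambda>_. 0} (lam k) (L k) (f k)" for k
    using zero_silent by (intro f_root_chain) simp
  have spec: "gen_spectrum y T {\<lambda>_. 0} = (if silent y T = {\<lambda>_. 0} then range lam else UNIV)"
    using gen_spectrum_modulo_silent gen_spectrum_with_silent by (cases "silent y T = {\<lambda>_. 0}") simp_all
  have "gen_root_vectors y T {\<lambda>_. 0} (lam k) =
      {g. \<exists>b. (\<exists>j\<in>{1..L k}. b j \<noteq> 0) \<and> g = (\<lambda>t. \<Sum>j=1..L k. b j * f k j t)}"
    if "silent y T = {\<lambda>_. 0}" for k
    using gen_root_vectors_modulo_silent[of k] unfolding that by simp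
  then show ?thesis
    using chain gen_spectrum_modulo_silent gen_root_vectors_modulo_silent spec by simp
qed

end
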